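(* Let $G\le\operatorname{Aut}(T_X)$ be a perfect, self-similar subgroup that satisfies property H. Let $Q\le\operatorname{Sym}(X)$ denote the image of $G$ under the canonical action on $X$. For every non-empty subset $\Omega\subseteq\mathcal{S}$, the canonical map $\operatorname{res}^{\Gamma_G^{\Omega}}_{T_X}$ defines an isomorphism from $\widehat{\Gamma_G^{\Omega}}$ onto $\wr_X^{\infty}Q\le\operatorname{Aut}(T_X)$.
   Context: Let $X$ be a non-empty finite set with a fixed element $o\in X$ and $X^+=X\setminus\{o\}$. $X^*$ is the set of finite words over $X$; $T_X$ is the rooted tree with vertex set $X^*$, root the empty word, and edges joining $w$ to $wx$ ($w\in X^*$, $x\in X$); level $\ell$ is $X^\ell$. $\operatorname{Aut}(T_X)$ is the group of root-fixing graph automorphisms. For $\alpha\in\operatorname{Aut}(T_X)$, $\sigma_\alpha\in\operatorname{Sym}(X)$ is the induced permutation of level 1, and for $x\in X$ the state $\alpha_x\in\operatorname{Aut}(T_X)$ is defined by $\alpha(xw)=\sigma_\alpha(x)\alpha_x(w)$ for all $w\in X^*$. A subgroup $G\le\operatorname{Aut}(T_X)$ is self-similar if $g_x\in G$ for all $g\in G,x\in X$. It has property H if it acts transitively on $X$ and for all $x\ne y$ in $X$ there is $g\in G$ with $g(x)=x$ and $g(y)\ne y$. $\mathcal{S}$ is the set of infinite sequences $\omega=(\omega_k)_{k\ge1}$ over $X^+$; $L(\omega_1,\omega_2,\dots)=(\omega_2,\omega_3,\dots)$. For $\alpha\in\operatorname{Aut}(T_X)$ and $\omega\in\mathcal{S}$,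 $\widetilde{\alpha}^{\omega}\in\operatorname{Aut}(T_X)$ fixes level 1 pointwise and is given recursively by its states: $\widetilde{\alpha}^{L(\omega)}$ at $o$, $\alpha$ at $\omega_1$, and $\operatorname{id}$ at every other $x\in X$. $\Gamma_G^{\Omega}$ is the subgroup of $\operatorname{Aut}(T_X)$ generated by $G$ and all $\widetilde{g}^{\omega}$ with $g\in G,\omega\in\Omega$. $\operatorname{Aut}(T_X)$ is a profinite group with the pointwise stabilizers of the levels $X^\ell$ as a base of neighbourhoods of the identity. For $\Gamma\le\operatorname{Aut}(T_X)$, $\widehat{\Gamma}=\varprojlim_N\Gamma/N$ ($N$ over the finite index normal subgroups) is the profinite completion, and $\operatorname{res}^{\Gamma}_{T_X}\colon\widehat{\Gamma}\to\overline{\Gamma}\le\operatorname{Aut}(T_X)$ is the canonical continuous homomorphism extending the inclusion of $\Gamma$ into its closure $\overline{\Gamma}$. For $Q\le\operatorname{Sym}(X)$, the $n$-fold iterated permutational wreath product $\wr_X^nQ=Q\wr_X(Q\wr_X(\cdots(Q\wr_XQ)\cdots))$ acts on $X^n$, where $G\wr_XH=G\ltimes H^X$ acts on $X\times Y$ (for $H$ acting on $Y$) by $(g\cdot(h_x))(x,y)=(g(x),h_x(y))$. $\wr_X^\infty Q=\varprojlim_n\wr_X^nQ$, with projections given by restricting the action on $X^{n+1}$ to the first $n$ coordinates; it acts on $T_X$ and is identified with its image, a closed subgroup of $\operatorname{Aut}(T_X)$. *)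

theory Defs
  imports "HOL-Algebra.Generated_Groups" "HOL-Algebra.Product_Groups" "HOL-Algebra.Bij" "HOL-Analysis.Abstract_Topology" "HOL-Analysis.Function_Topology"
begin

text \<open>
  The finite non-empty set \<open>X\<close> is a type \<open>'a\<close> of class \<open>finite\<close>, so that \<open>X\<^sup>*\<close> is the
  type \<open>'a list\<close>. The distinguished letter \<open>o\<close> is written \<open>b\<close> (\<open>o\<close> is reserved syntax).
\<close>

section \<open>The rooted tree and its automorphisms\<close>

definition tree_adj :: "'a list \<Rightarrow> 'a list \<Rightarrow> bool" where
  "tree_adj v w \<longleftrightarrow> (\<exists>x. w = v @ [x] \<or> v = w @ [x])"

definition tree_auts :: "('a list \<Rightarrow> 'a list) set" where
  "tree_auts = {f. bij f \<and> f [] = [] \<and> (\<forall>v w. tree_adj (f v) (f w) \<longleftrightarrow> tree_adj v w)}"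

definition tree_Aut :: "('a list \<Rightarrow> 'a list) monoid" where
  "tree_Aut = (BijGroup UNIV)\<lparr>carrier := tree_auts\<rparr>"

abbreviation aut_group :: "('a list \<Rightarrow> 'a list) set \<Rightarrow> ('a list \<Rightarrow> 'a list) monoid" where
  "aut_group \<Gamma> \<equiv> tree_Aut\<lparr>carrier := \<Gamma>\<rparr>"

lemma tree_aut_length:
  assumes f: "f \<in> tree_auts"
  shows "length (f w) = length w" and "f (butlast w) = butlast (f w)"
proof -
  have inj: "inj f" and nil: "f [] = []" and adj: "\<And>v w. tree_adj (f v) (f w) \<longleftrightarrow> tree_adj v w"
    using f by (auto simp: tree_auts_def bij_def)
  have "length (f w) = length w \<and> f (butlast w) = butlast (f w)"
  proof (induction w rule: rev_induct)
    case Nil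
    show ?case by (simp add: nil)
  next
    case (snoc x v)
    have "tree_adj (f v) (f (v @ [x]))"
      by (simp only: adj) (simp add: tree_adj_def)
    then obtain y where "f (v @ [x]) = f v @ [y] \<or> f v = f (v @ [x]) @ [y]"
      by (auto simp: tree_adj_def)
    moreover have "f v \<noteq> f (v @ [x]) @ [y]"
    proof
      assume "f v = f (v @ [x]) @ [y]"
      then have "f (butlast v) = f (v @ [x])"
        using snoc.IH by simp
      then have "butlast v = v @ [x]"
        using inj by (simp add: inj_eq)
      then show False
        by (auto dest: arg_cong[of _ _ length])
    qed
    ultimately show ?case
      using snoc.IH by simp
  qed
  then show "length (f w) = length w" "f (butlast w) = butlast (f w)"
    by auto
qed

lemma tree_aut_take:
  assumes f: "f \<in> tree_auts"
  shows "take (length v) (f (v @ u)) = f v"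
proof (induction u rule: rev_induct)
  case Nil
  show ?case by (simp add: tree_aut_length(1)[OF f])
next
  case (snoc x u)
  have eq: "butlast (f (v @ u @ [x])) = f (v @ u)"
    using tree_aut_length(2)[OF f, of "v @ u @ [x]"] by (simp add: butlast_append)
  have "length v < length (f (v @ u @ [x]))"
    unfolding tree_aut_length(1)[OF f] by simp
  from take_butlast[OF this] show ?case
    unfolding eq snoc.IH by simp
qed

definition level_perm :: "('a list \<Rightarrow> 'a list) \<Rightarrow> 'a \<Rightarrow> 'a" where
  "level_perm \<alpha> x = hd (\<alpha> [x])"

definition tree_state :: "('a list \<Rightarrow> 'a list) \<Rightarrow> 'a \<Rightarrow> 'a list \<Rightarrow> 'a list" where
  "tree_state \<alpha> x w = tl (\<alpha> (x # w))"

text \<open>The defining equation \<open>\<alpha>(xw) = \<sigma>\<^sub>\<alpha>(x) \<alpha>\<^sub>x(w)\<close>:\<close>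

lemma tree_aut_Cons:
  assumes "f \<in> tree_auts"
  shows "f (x # w) = level_perm f x # tree_state f x w"
proof -
  have l: "length (f (x # w)) = Suc (length w)"
    by (simp only: tree_aut_length(1)[OF assms] list.size)
  then obtain y u where yu: "f (x # w) = y # u"
    by (cases "f (x # w)") auto
  have "f [x] = [y]"
    using tree_aut_take[OF assms, of "[x]" w] yu by simp
  with yu show ?thesis
    by (simp add: level_perm_def tree_state_def)
qed

definition self_similar :: "('a list \<Rightarrow> 'a list) set \<Rightarrow> bool" where
  "self_similar G \<longleftrightarrow> (\<forall>g\<in>G. \<forall>x. tree_state g x \<in> G)"

definition property_H :: "('a list \<Rightarrow> 'a list) set \<Rightarrow> bool" where
  "property_H G \<longleftrightarrow>
     (\<forall>x y. \<exists>g\<in>G. level_perm g x = y) \<and>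
     (\<forall>x y. x \<noteq> y \<longrightarrow> (\<exists>g\<in>G. level_perm g x = x \<and> level_perm g y \<noteq> y))"

definition perfect_group :: "('g, 'm) monoid_scheme \<Rightarrow> bool" where
  "perfect_group G \<longleftrightarrow> derived G (carrier G) = carrier G"


section \<open>The groups \<open>\<Gamma>\<^sub>G\<^sup>\<Omega>\<close>\<close>

text \<open>Sequences are indexed from \<open>0\<close>: \<open>\<omega> 0\<close> is the first term \<open>\<omega>\<^sub>1\<close>.\<close>

definition letter_seqs :: "'a \<Rightarrow> (nat \<Rightarrow> 'a) set" where
  "letter_seqs b = {\<omega>. \<forall>k. \<omega> k \<noteq> b}"

definition seq_shift :: "(nat \<Rightarrow> 'a) \<Rightarrow> nat \<Rightarrow> 'a" where
  "seq_shift \<omega> = (\<lambda>k. \<omega> (Suc k))"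

fun tilde :: "'a \<Rightarrow> ('a list \<Rightarrow> 'a list) \<Rightarrow> (nat \<Rightarrow> 'a) \<Rightarrow> 'a list \<Rightarrow> 'a list" where
  "tilde b \<alpha> \<omega> [] = []"
| "tilde b \<alpha> \<omega> (x # w) =
     x # (if x = b then tilde b \<alpha> (seq_shift \<omega>) w else if x = \<omega> 0 then \<alpha> w else w)"

definition Gamma :: "'a \<Rightarrow> ('a list \<Rightarrow> 'a list) set \<Rightarrow> (nat \<Rightarrow> 'a) set \<Rightarrow> ('a list \<Rightarrow> 'a list) set" where
  "Gamma b G \<Omega> = generate tree_Aut (G \<union> {tilde b g \<omega> | g \<omega>. g \<in> G \<and> \<omega> \<in> \<Omega>})"


section \<open>Inverse limits and profinite completions\<close>

text \<open>\<open>p i j\<close> is the transition map from the \<open>j\<close>-th group to the \<open>i\<close>-th, for \<open>R i j\<close>.\<close>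

definition inverse_limit ::
  "'i set \<Rightarrow> ('i \<Rightarrow> 'i \<Rightarrow> bool) \<Rightarrow> ('i \<Rightarrow> ('g, 'm) monoid_scheme) \<Rightarrow> ('i \<Rightarrow> 'i \<Rightarrow> 'g \<Rightarrow> 'g)
     \<Rightarrow> ('i \<Rightarrow> 'g) monoid" where
  "inverse_limit I R G p = (product_group I G)
     \<lparr>carrier := {f \<in> carrier (product_group I G).
        \<forall>i\<in>I. \<forall>j\<in>I. R i j \<longrightarrow> p i j (f j) = f i}\<rparr>"

definition finite_index_normal :: "('g, 'm) monoid_scheme \<Rightarrow> 'g set set" where
  "finite_index_normal \<Gamma> = {N. N \<lhd> \<Gamma> \<and> finite (rcosets\<^bsub>\<Gamma>\<^esub> N)}"

text \<open>For \<open>M \<subseteq> N\<close> the projection \<open>\<Gamma>/M \<rightarrow> \<Gamma>/N\<close> maps a coset \<open>C\<close> to \<open>N C\<close>.\<close>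

definition profinite_completion :: "('g, 'm) monoid_scheme \<Rightarrow> ('g set \<Rightarrow> 'g set) monoid" where
  "profinite_completion \<Gamma> =
     inverse_limit (finite_index_normal \<Gamma>) (\<lambda>N M. M \<subseteq> N) (\<lambda>N. \<Gamma> Mod N) (\<lambda>N M C. N <#>\<^bsub>\<Gamma>\<^esub> C)"

definition profinite_topology :: "('g, 'm) monoid_scheme \<Rightarrow> ('g set \<Rightarrow> 'g set) topology" where
  "profinite_topology \<Gamma> = subtopology
     (product_topology (\<lambda>N. discrete_topology (carrier (\<Gamma> Mod N))) (finite_index_normal \<Gamma>))
     (carrier (profinite_completion \<Gamma>))"

definition completion_map :: "('g, 'm) monoid_scheme \<Rightarrow> 'g \<Rightarrow> 'g set \<Rightarrow> 'g set" where
  "completion_map \<Gamma> \<gamma> = (\<lambda>N \<in> finite_index_normal \<Gamma>. N #>\<^bsub>\<Gamma>\<^esub> \<gamma>)"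


section \<open>The topology of the automorphism group and the canonical map\<close>

definition level_stab :: "nat \<Rightarrow> ('a list \<Rightarrow> 'a list) set" where
  "level_stab l = {g \<in> tree_auts. \<forall>w. length w = l \<longrightarrow> g w = w}"

definition tree_topology :: "('a list \<Rightarrow> 'a list) topology" where
  "tree_topology = topology_generated_by {g <#\<^bsub>tree_Aut\<^esub> level_stab l | g l. g \<in> tree_auts}"

text \<open>
  \<open>is_res \<Gamma> r\<close>: \<open>r\<close> is a continuous homomorphism from the profinite completion to the closure
  of \<open>\<Gamma>\<close> extending the inclusion of \<open>\<Gamma>\<close>. It is unique on the completion, because \<open>\<Gamma>\<close> has dense
  image there; extensionality fixes the irrelevant values outside.
\<close>

definition is_res ::
  "('a list \<Rightarrow> 'a list) set
     \<Rightarrow> ((('a list \<Rightarrow> 'a list) set \<Rightarrow> ('a list \<Rightarrow> 'a list) set) \<Rightarrow> 'a list \<Rightarrow> 'a list) \<Rightarrow> bool" where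
  "is_res \<Gamma> r \<longleftrightarrow>
     r \<in> hom (profinite_completion (aut_group \<Gamma>)) (aut_group (tree_topology closure_of \<Gamma>)) \<and>
     continuous_map (profinite_topology (aut_group \<Gamma>))
       (subtopology tree_topology (tree_topology closure_of \<Gamma>)) r \<and>
     (\<forall>\<gamma>\<in>\<Gamma>. r (completion_map (aut_group \<Gamma>) \<gamma>) = \<gamma>) \<and>
     r \<in> extensional (carrier (profinite_completion (aut_group \<Gamma>)))"

definition res_tree ::
  "('a list \<Rightarrow> 'a list) set
     \<Rightarrow> (('a list \<Rightarrow> 'a list) set \<Rightarrow> ('a list \<Rightarrow> 'a list) set) \<Rightarrow> 'a list \<Rightarrow> 'a list" where
  "res_tree \<Gamma> = (THE r. is_res \<Gamma> r)"


section \<open>Iterated permutational wreath products\<close>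

text \<open>
  The groups \<open>\<wr>\<^sub>X\<^sup>n Q\<close> live in one type: \<open>Wr q h\<close> is the element \<open>q \<cdot> (h\<^sub>x)\<^sub>x\<close> of
  \<open>Q \<wr>\<^sub>X H = Q \<ltimes> H\<^sup>X\<close>. The recursion starts with the trivial group \<open>{Unit}\<close> at \<open>n = 0\<close>, which acts
  on \<open>X\<^sup>0 = {[]}\<close>; then the group at \<open>n = 1\<close> is \<open>Q \<wr>\<^sub>X 1 = Q\<close>.
\<close>

datatype 'a wreath = Unit | Wr "'a \<Rightarrow> 'a" "'a \<Rightarrow> 'a wreath"

primrec wreath_carrier :: "('a \<Rightarrow> 'a) set \<Rightarrow> nat \<Rightarrow> 'a wreath set" where
  "wreath_carrier Q 0 = {Unit}"
| "wreath_carrier Q (Suc n) = {Wr q h | q h. q \<in> Q \<and> (\<forall>x. h x \<in> wreath_carrier Q n)}"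

text \<open>
  The product of \<open>q \<cdot> (h\<^sub>x)\<close> and \<open>q' \<cdot> (h'\<^sub>x)\<close> is determined by the action
  \<open>(x, y) \<mapsto> (q x, h\<^sub>x y)\<close> on \<open>X \<times> Y\<close>.
\<close>

primrec wreath_mult :: "'a wreath \<Rightarrow> 'a wreath \<Rightarrow> 'a wreath" where
  "wreath_mult Unit t = Unit"
| "wreath_mult (Wr q h) t =
     (case t of Unit \<Rightarrow> Unit | Wr q' h' \<Rightarrow> Wr (q \<circ> q') (\<lambda>x. wreath_mult (h (q' x)) (h' x)))"

primrec wreath_one :: "nat \<Rightarrow> 'a wreath" where
  "wreath_one 0 = Unit"
| "wreath_one (Suc n) = Wr id (\<lambda>_. wreath_one n)"

definition wreath_power :: "('a \<Rightarrow> 'a) set \<Rightarrow> nat \<Rightarrow> 'a wreath monoid" where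
  "wreath_power Q n = \<lparr>carrier = wreath_carrier Q n, monoid.mult = wreath_mult, one = wreath_one n\<rparr>"

fun wreath_act :: "'a wreath \<Rightarrow> 'a list \<Rightarrow> 'a list" where
  "wreath_act (Wr q h) (x # w) = q x # wreath_act (h x) w"
| "wreath_act t w = []"

lemma wreath_act_mult:
  "a \<in> wreath_carrier Q n \<Longrightarrow> c \<in> wreath_carrier Q n \<Longrightarrow> length v = n \<Longrightarrow>
     wreath_act (wreath_mult a c) v = wreath_act a (wreath_act c v)"
proof (induction n arbitrary: a c v)
  case (Suc n)
  then show ?case by (cases v) auto
qed simp

fun wreath_trunc :: "nat \<Rightarrow> 'a wreath \<Rightarrow> 'a wreath" where
  "wreath_trunc (Suc n) (Wr q h) = Wr q (\<lambda>x. wreath_trunc n (h x))"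
| "wreath_trunc n t = Unit"

text \<open>The truncation \<open>\<wr>\<^sub>X\<^sup>n\<^sup>+\<^sup>k Q \<rightarrow> \<wr>\<^sub>X\<^sup>n Q\<close> is the restriction of the action to the first \<open>n\<close> letters.\<close>

lemma wreath_act_trunc:
  "a \<in> wreath_carrier Q (n + k) \<Longrightarrow> length v = n \<Longrightarrow> length u = k \<Longrightarrow>
     wreath_act (wreath_trunc n a) v = take n (wreath_act a (v @ u))"
proof (induction n arbitrary: a v)
  case (Suc n)
  then show ?case by (cases v) auto
qed simp

definition wreath_limit :: "('a \<Rightarrow> 'a) set \<Rightarrow> (nat \<Rightarrow> 'a wreath) monoid" where
  "wreath_limit Q = inverse_limit UNIV (\<le>) (wreath_power Q) (\<lambda>n m. wreath_trunc n)"

definition wreath_limit_act :: "(nat \<Rightarrow> 'a wreath) \<Rightarrow> 'a list \<Rightarrow> 'a list" where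
  "wreath_limit_act t w = wreath_act (t (length w)) w"

definition wreath_infinity :: "('a \<Rightarrow> 'a) set \<Rightarrow> ('a list \<Rightarrow> 'a list) set" where
  "wreath_infinity Q = wreath_limit_act ` carrier (wreath_limit Q)"

end

theory Submission
  imports Defs
begin

text \<open>
  Write \<open>\<Gamma>\<^sup>\<Omega>\<close> for the generated group and \<open>L \<Omega>\<close> for the set of shifted sequences. Everything rests on
  one decomposition (\<open>Gamma_iff\<close>): an automorphism lies in \<open>\<Gamma>\<^sup>\<Omega>\<close> exactly if it acts on the first level
  by an element of \<open>Q\<close> and all its states lie in \<open>\<Gamma>\<^sup>L\<^sup>\<Omega>\<close>. To see this, take \<open>\<omega> \<in> \<Omega>\<close> with first letter \<open>c\<close>
  and, by property H, some \<open>a \<in> G\<close> that fixes \<open>c\<close> and moves the base letter \<open>b\<close>. The generator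
  belonging to \<open>g\<close> and \<open>\<omega>\<close> lives below \<open>b\<close> and \<open>c\<close>; a conjugate by \<open>a\<close> of another such generator lives
  below \<open>a b\<close> and \<open>c\<close>. Their commutator lives below \<open>c\<close> only and is an arbitrary commutator of \<open>G\<close>
  there, so perfectness puts a copy of \<open>G\<close> acting below \<open>c\<close> alone into \<open>\<Gamma>\<^sup>\<Omega>\<close>
  (\<open>at_first_letter_G\<close>). Dividing it off the generators leaves copies of the shifted generators below
  \<open>b\<close>, hence all of \<open>\<Gamma>\<^sup>L\<^sup>\<Omega>\<close> below \<open>b\<close>, and transitivity of \<open>G\<close> spreads it to every letter
  (\<open>at_letter_Gamma\<close>).

  Iterating the decomposition, \<open>\<Gamma>\<^sup>\<Omega>\<close> realises on each level \<open>n\<close> every automorphism whose local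
  permutations are in \<open>Q\<close>, so its closure is the infinite wreath product (\<open>closure_Gamma\<close>). It also
  shows that the stabilizer of level \<open>n\<close> is the product of copies of \<open>\<Gamma>\<close> for the \<open>n\<close>-fold shift of \<open>\<Omega>\<close>,
  one below each vertex of that level (\<open>level_stab_generated\<close>).

  For the profinite completion it remains to see that every normal subgroup \<open>N\<close> of finite index
  contains a level stabilizer (\<open>congruence_Gamma\<close>). If \<open>\<nu> \<in> N\<close> moves a vertex \<open>v\<close>, then for \<open>f\<close>, \<open>h\<close>
  supported below \<open>v\<close> the conjugate of \<open>f\<close> by \<open>\<nu>\<close> commutes with \<open>h\<close>, and the double commutator
  \<open>[[\<nu>, f], h] = [f\<inverse>, h]\<close> is in \<open>N\<close>. All groups \<open>\<Gamma>\<^sup>\<Omega>\<close> are perfect, being generated by copies of \<open>G\<close>, so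
  \<open>N\<close> contains the copy below \<open>v\<close>, by level transitivity the copies below all vertices of that level,
  and therefore the stabilizer of the level (\<open>normal_subgroup_contains_level_stab\<close>).

  Given this congruence property, a compatible family of cosets is the same as a compatible family of
  actions on the levels, that is, an element of the closure; and two families agree on the quotient
  by a level stabilizer exactly if the two automorphisms agree on that level. So the canonical map
  is a bijective homomorphism that matches the two neighbourhood bases.
\<close>

section \<open>The group of tree automorphisms\<close>

abbreviation inverse_map :: "('b \<Rightarrow> 'b) \<Rightarrow> 'b \<Rightarrow> 'b" where
  "inverse_map f \<equiv> inv_into UNIV f"

lemma inverse_map_apply [simp]:
  assumes "bij f" shows "inverse_map f (f w) = w" and "f (inverse_map f w) = w"
  using assms by (auto simp: bij_def inj_def surj_f_inv_f)

lemma inverse_map_comp [simp]: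
  assumes "bij f" shows "inverse_map f \<circ> f = id" and "f \<circ> inverse_map f = id"
  using assms by auto

lemma tree_autD:
  assumes "f \<in> tree_auts"
  shows "bij f" "f [] = []" "inj f" "surj f"
  using assms by (auto simp: tree_auts_def bij_def)

lemma Bij_UNIV: "Bij UNIV = {f. bij f}"
  by (auto simp: Bij_def)

lemma tree_Aut_simps [simp]:
  "carrier tree_Aut = tree_auts"
  "one tree_Aut = id"
  by (auto simp: tree_Aut_def BijGroup_def)

lemma tree_Aut_mult [simp]:
  assumes "\<alpha> \<in> tree_auts" "\<beta> \<in> tree_auts"
  shows "\<alpha> \<otimes>\<^bsub>tree_Aut\<^esub> \<beta> = \<alpha> \<circ> \<beta>"
  using assms by (simp add: tree_Aut_def BijGroup_def Bij_UNIV tree_autD(1) compose_def comp_def restrict_def)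

lemma id_tree_aut [simp]: "id \<in> tree_auts"
  by (simp add: tree_auts_def)

lemma comp_tree_aut:
  assumes "\<alpha> \<in> tree_auts" "\<beta> \<in> tree_auts"
  shows "\<alpha> \<circ> \<beta> \<in> tree_auts"
  using assms by (auto simp: tree_auts_def bij_comp)

lemma inverse_tree_aut:
  assumes "\<alpha> \<in> tree_auts"
  shows "inverse_map \<alpha> \<in> tree_auts"
proof -
  have b: "bij \<alpha>" and n: "\<alpha> [] = []" and adj: "\<And>v w. tree_adj (\<alpha> v) (\<alpha> w) \<longleftrightarrow> tree_adj v w"
    using assms by (auto simp: tree_auts_def)
  have "tree_adj (inverse_map \<alpha> v) (inverse_map \<alpha> w) \<longleftrightarrow> tree_adj v w" for v w
    using adj[of "inverse_map \<alpha> v" "inverse_map \<alpha> w"] b by simp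
  moreover have "inverse_map \<alpha> [] = []"
    using inverse_map_apply(1)[OF b, of "[]"] n by simp
  ultimately show ?thesis
    using b by (simp add: tree_auts_def bij_imp_bij_inv)
qed

lemma group_tree_Aut: "group tree_Aut"
proof (rule groupI)
  fix \<alpha> \<beta> \<gamma> :: "'a list \<Rightarrow> 'a list"
  assume a: "\<alpha> \<in> carrier tree_Aut" "\<beta> \<in> carrier tree_Aut" "\<gamma> \<in> carrier tree_Aut"
  then show "\<alpha> \<otimes>\<^bsub>tree_Aut\<^esub> \<beta> \<otimes>\<^bsub>tree_Aut\<^esub> \<gamma> = \<alpha> \<otimes>\<^bsub>tree_Aut\<^esub> (\<beta> \<otimes>\<^bsub>tree_Aut\<^esub> \<gamma>)"
    by (simp add: comp_tree_aut comp_assoc)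
next
  fix \<alpha> :: "'a list \<Rightarrow> 'a list"
  assume "\<alpha> \<in> carrier tree_Aut"
  then show "\<exists>\<beta>\<in>carrier tree_Aut. \<beta> \<otimes>\<^bsub>tree_Aut\<^esub> \<alpha> = \<one>\<^bsub>tree_Aut\<^esub>"
    by (intro bexI[of _ "inverse_map \<alpha>"]) (auto simp: inverse_tree_aut tree_autD(1))
qed (auto simp: comp_tree_aut)

lemma tree_Aut_inv [simp]:
  assumes "\<alpha> \<in> tree_auts"
  shows "inv\<^bsub>tree_Aut\<^esub> \<alpha> = inverse_map \<alpha>"
  by (rule group.inv_equality[OF group_tree_Aut])
     (use assms in \<open>simp_all add: inverse_tree_aut tree_autD(1)\<close>)

lemma subgroup_tree_Aut_iff:
  "subgroup H tree_Aut \<longleftrightarrow>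
     H \<subseteq> tree_auts \<and> id \<in> H \<and> (\<forall>\<alpha>\<in>H. \<forall>\<beta>\<in>H. \<alpha> \<circ> \<beta> \<in> H) \<and> (\<forall>\<alpha>\<in>H. inverse_map \<alpha> \<in> H)"
proof
  assume H: "subgroup H tree_Aut"
  then have "H \<subseteq> tree_auts"
    using subgroup.subset by fastforce
  moreover from this have "\<alpha> \<circ> \<beta> \<in> H" if "\<alpha> \<in> H" "\<beta> \<in> H" for \<alpha> \<beta>
    using subgroup.m_closed[OF H that] that by (simp add: subset_iff)
  moreover from calculation(1) have "inverse_map \<alpha> \<in> H" if "\<alpha> \<in> H" for \<alpha>
    using subgroup.m_inv_closed[OF H that] that by (simp add: subset_iff)
  ultimately show "H \<subseteq> tree_auts \<and> id \<in> H \<and> (\<forall>\<alpha>\<in>H. \<forall>\<beta>\<in>H. \<alpha> \<circ> \<beta> \<in> H) \<and> (\<forall>\<alpha>\<in>H. inverse_map \<alpha> \<in> H)"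
    using subgroup.one_closed[OF H] by simp
next
  assume "H \<subseteq> tree_auts \<and> id \<in> H \<and> (\<forall>\<alpha>\<in>H. \<forall>\<beta>\<in>H. \<alpha> \<circ> \<beta> \<in> H) \<and> (\<forall>\<alpha>\<in>H. inverse_map \<alpha> \<in> H)"
  then show "subgroup H tree_Aut"
    by (intro group.subgroupI[OF group_tree_Aut]) (auto simp: subset_iff)
qed

lemma subgroup_tree_AutD:
  assumes "subgroup H tree_Aut"
  shows "H \<subseteq> tree_auts" "id \<in> H"
    and "\<alpha> \<in> H \<Longrightarrow> \<beta> \<in> H \<Longrightarrow> \<alpha> \<circ> \<beta> \<in> H" "\<alpha> \<in> H \<Longrightarrow> inverse_map \<alpha> \<in> H"
    and "\<alpha> \<in> H \<Longrightarrow> \<alpha> \<in> tree_auts" "\<alpha> \<in> H \<Longrightarrow> bij \<alpha>"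
  using assms unfolding subgroup_tree_Aut_iff by (auto simp: tree_autD(1) subset_iff)


section \<open>Levels\<close>

definition agree :: "nat \<Rightarrow> ('a list \<Rightarrow> 'a list) \<Rightarrow> ('a list \<Rightarrow> 'a list) \<Rightarrow> bool" where
  "agree n \<alpha> \<beta> \<longleftrightarrow> (\<forall>w. length w = n \<longrightarrow> \<alpha> w = \<beta> w)"

lemma agree_refl [simp]: "agree n \<alpha> \<alpha>"
  and agree_sym: "agree n \<alpha> \<beta> \<Longrightarrow> agree n \<beta> \<alpha>"
  and agree_trans: "agree n \<alpha> \<beta> \<Longrightarrow> agree n \<beta> \<gamma> \<Longrightarrow> agree n \<alpha> \<gamma>"
  by (auto simp: agree_def)

text \<open>
  Padding \<open>w\<close> to a word of length \<open>n\<close> works because automorphisms preserve prefixes; the letters used for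
  padding are arbitrary.
\<close>

lemma agree_le:
  assumes "\<alpha> \<in> tree_auts" "\<beta> \<in> tree_auts" "agree n \<alpha> \<beta>" "length w \<le> n"
  shows "\<alpha> w = \<beta> w"
proof -
  define u :: "'a list" where "u = replicate (n - length w) undefined"
  have "\<alpha> (w @ u) = \<beta> (w @ u)"
    using assms by (simp add: agree_def u_def)
  then show ?thesis
    using tree_aut_take[OF assms(1), of w u] tree_aut_take[OF assms(2), of w u] by simp
qed

lemma agree_mono:
  assumes "\<alpha> \<in> tree_auts" "\<beta> \<in> tree_auts" "agree n \<alpha> \<beta>" "m \<le> n"
  shows "agree m \<alpha> \<beta>"
  using agree_le[OF assms(1-3)] assms(4) by (simp add: agree_def)

lemma agree_comp:
  assumes "\<beta> \<in> tree_auts" "agree n \<alpha> \<alpha>'" "agree n \<beta> \<beta>'"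
  shows "agree n (\<alpha> \<circ> \<beta>) (\<alpha>' \<circ> \<beta>')"
proof -
  have "length (\<beta> w) = length w" for w
    by (rule tree_aut_length(1)[OF assms(1)])
  then show ?thesis
    using assms(2,3) unfolding agree_def by (metis comp_apply)
qed

lemma agree_eqI:
  assumes "\<And>n. agree n \<alpha> \<beta>" shows "\<alpha> = \<beta>"
  using assms by (auto simp: agree_def fun_eq_iff)

lemma level_stab_iff: "\<alpha> \<in> level_stab n \<longleftrightarrow> \<alpha> \<in> tree_auts \<and> agree n \<alpha> id"
  by (auto simp: level_stab_def agree_def)

text \<open>
  All defining conditions involve at most two words at a time, so they can be checked on an initial
  part of the tree. This is how functions given by infinite recursion or as limits are recognised as
  automorphisms.
\<close>

lemma tree_aut_levelwiseI:
  assumes "\<And>n. \<exists>\<beta>\<in>tree_auts. \<forall>w. length w \<le> n \<longrightarrow> f w = \<beta> w"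
  shows "f \<in> tree_auts"
proof -
  have two: "\<exists>\<beta>\<in>tree_auts. f v = \<beta> v \<and> f w = \<beta> w \<and> inj \<beta>" for v w
    using assms[of "max (length v) (length w)"] by (metis max.cobounded1 max.cobounded2 tree_autD(3))
  have "inj f"
    by (rule injI) (metis two injD)
  moreover have "\<exists>v. f v = w" for w
  proof -
    obtain \<beta> where \<beta>: "\<beta> \<in> tree_auts" "\<forall>v. length v \<le> length w \<longrightarrow> f v = \<beta> v"
      using assms by blast
    obtain v where "\<beta> v = w"
      using tree_autD(4)[OF \<beta>(1)] by (metis surjD)
    then show ?thesis
      using \<beta> tree_aut_length(1)[OF \<beta>(1), of v] by auto
  qed
  ultimately have "bij f"
    by (metis bij_def surjI)
  moreover have "f [] = []"
    using two[of "[]" "[]"] tree_autD(2) by metis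
  moreover have "tree_adj (f v) (f w) \<longleftrightarrow> tree_adj v w" for v w
    using two[of v w] by (auto simp: tree_auts_def)
  ultimately show ?thesis
    by (simp add: tree_auts_def)
qed


section \<open>Level permutation and states\<close>

text \<open>
  The map with level permutation \<open>q\<close> and states \<open>h\<close>. Writing automorphisms in this form turns
  products into the multiplication rule of a permutational wreath product.
\<close>

fun tree_node :: "('a \<Rightarrow> 'a) \<Rightarrow> ('a \<Rightarrow> 'a list \<Rightarrow> 'a list) \<Rightarrow> 'a list \<Rightarrow> 'a list" where
  "tree_node q h [] = []"
| "tree_node q h (x # w) = q x # h x w"

lemma tree_node_comp:
  "tree_node q h \<circ> tree_node q' h' = tree_node (q \<circ> q') (\<lambda>x. h (q' x) \<circ> h' x)"
proof
  show "(tree_node q h \<circ> tree_node q' h') w = tree_node (q \<circ> q') (\<lambda>x. h (q' x) \<circ> h' x) w" for w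
    by (cases w) auto
qed

lemma tree_node_id [simp]: "tree_node id (\<lambda>x. id) = id"
proof
  show "tree_node id (\<lambda>x. id) w = id w" for w :: "'a list"
    by (cases w) auto
qed

lemma level_perm_node [simp]: "level_perm (tree_node q h) = q"
  by (auto simp: level_perm_def fun_eq_iff)

lemma tree_state_node [simp]: "tree_state (tree_node q h) = h"
  by (auto simp: tree_state_def fun_eq_iff)

lemma tree_node_eq:
  assumes "\<alpha> \<in> tree_auts"
  shows "tree_node (level_perm \<alpha>) (tree_state \<alpha>) = \<alpha>"
proof
  show "tree_node (level_perm \<alpha>) (tree_state \<alpha>) w = \<alpha> w" for w
    using tree_aut_Cons[OF assms] tree_autD(2)[OF assms] by (cases w) auto
qed

lemma tree_adj_Cons [simp]:
  "tree_adj (x # v) (y # w) \<longleftrightarrow> x = y \<and> tree_adj v w"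
  "tree_adj [] (y # w) \<longleftrightarrow> w = []" "tree_adj (y # w) [] \<longleftrightarrow> w = []"
  by (auto simp: tree_adj_def)

lemma tree_node_tree_aut_iff:
  fixes q :: "'a::finite \<Rightarrow> 'a"
  shows "tree_node q h \<in> tree_auts \<longleftrightarrow> bij q \<and> (\<forall>x. h x \<in> tree_auts)"
proof
  assume *: "bij q \<and> (\<forall>x. h x \<in> tree_auts)"
  then have q: "inj q" "surj q" and h: "\<And>x. inj (h x)" "\<And>x. surj (h x)"
    and adj: "\<And>x v w. tree_adj (h x v) (h x w) \<longleftrightarrow> tree_adj v w"
    unfolding tree_auts_def bij_def by blast+
  have nil_iff: "h x w = [] \<longleftrightarrow> w = []" for x w
    using tree_aut_length(1)[of "h x" w] * by (metis length_0_conv)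
  have "inj (tree_node q h)"
  proof (rule injI)
    fix v w assume "tree_node q h v = tree_node q h w"
    then show "v = w"
      using q(1) h(1) by (cases v; cases w) (auto dest: injD)
  qed
  moreover have "\<exists>v. tree_node q h v = w" for w
  proof (cases w)
    case (Cons y u)
    obtain x where "q x = y"
      using q(2) by (metis surjD)
    moreover obtain v where "h x v = u"
      using h(2) by (metis surjD)
    ultimately show ?thesis
      using Cons by (intro exI[of _ "x # v"]) simp
  qed (auto intro: exI[of _ "[]"])
  ultimately have "bij (tree_node q h)"
    by (metis bij_def surjI)
  moreover have "tree_adj (tree_node q h v) (tree_node q h w) \<longleftrightarrow> tree_adj v w" for v w
    using q(1) adj nil_iff by (cases v; cases w) (auto simp: inj_eq)
  ultimately show "tree_node q h \<in> tree_auts"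
    by (simp add: tree_auts_def)
next
  assume *: "tree_node q h \<in> tree_auts"
  let ?t = "tree_node q h"
  have inj: "inj ?t" and surj: "surj ?t"
    and adj: "\<And>v w. tree_adj (?t v) (?t w) \<longleftrightarrow> tree_adj v w"
    using * unfolding tree_auts_def bij_def by blast+
  have nil: "h x [] = []" for x
    using tree_aut_length(1)[OF *, of "[x]"] by simp
  have "inj q"
  proof (rule injI)
    fix x y assume "q x = q y"
    have "?t [x] = ?t [y]"
      using \<open>q x = q y\<close> by (simp add: nil)
    then show "x = y"
      using injD[OF inj, of "[x]" "[y]"] by blast
  qed
  then have q: "bij q"
    by (simp add: bij_def finite_UNIV_inj_surj)
  have "h x \<in> tree_auts" for x
  proof -
    have "inj (h x)"
    proof (rule injI)
      fix v w assume "h x v = h x w"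
      then have "?t (x # v) = ?t (x # w)"
        by simp
      then show "v = w"
        using injD[OF inj, of "x # v" "x # w"] by blast
    qed
    moreover have "\<exists>v. h x v = w" for w
    proof -
      obtain v where v: "?t v = q x # w"
        using surj by (metis surjD)
      then show ?thesis
        using \<open>inj q\<close> by (cases v) (auto dest: injD)
    qed
    ultimately have "bij (h x)"
      by (metis bij_def surjI)
    then show ?thesis
      using adj[of "x # _" "x # _"] nil by (simp add: tree_auts_def)
  qed
  with q show "bij q \<and> (\<forall>x. h x \<in> tree_auts)"
    by blast
qed

lemma tree_aut_node:
  fixes \<alpha> :: "'a::finite list \<Rightarrow> 'a list"
  assumes "\<alpha> \<in> tree_auts"
  shows "bij (level_perm \<alpha>)" "tree_state \<alpha> x \<in> tree_auts"
  using assms tree_node_tree_aut_iff[of "level_perm \<alpha>" "tree_state \<alpha>"] tree_node_eq[OF assms] by auto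

lemma level_perm_comp:
  assumes "\<alpha> \<in> tree_auts" "\<beta> \<in> tree_auts"
  shows "level_perm (\<alpha> \<circ> \<beta>) = level_perm \<alpha> \<circ> level_perm \<beta>"
    and "tree_state (\<alpha> \<circ> \<beta>) x = tree_state \<alpha> (level_perm \<beta> x) \<circ> tree_state \<beta> x"
proof -
  have "\<alpha> \<circ> \<beta> = tree_node (level_perm \<alpha> \<circ> level_perm \<beta>)
      (\<lambda>x. tree_state \<alpha> (level_perm \<beta> x) \<circ> tree_state \<beta> x)"
    using tree_node_comp tree_node_eq assms by metis
  then show "level_perm (\<alpha> \<circ> \<beta>) = level_perm \<alpha> \<circ> level_perm \<beta>"
    "tree_state (\<alpha> \<circ> \<beta>) x = tree_state \<alpha> (level_perm \<beta> x) \<circ> tree_state \<beta> x"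
    by simp_all
qed

lemma level_perm_id [simp]: "level_perm id = id" "tree_state id x = id"
  by (auto simp: level_perm_def tree_state_def fun_eq_iff)

lemma level_perm_inverse:
  fixes \<alpha> :: "'a::finite list \<Rightarrow> 'a list"
  assumes "\<alpha> \<in> tree_auts"
  shows "level_perm (inverse_map \<alpha>) = inverse_map (level_perm \<alpha>)"
    and "tree_state (inverse_map \<alpha>) x = inverse_map (tree_state \<alpha> (inverse_map (level_perm \<alpha>) x))"
proof -
  let ?\<beta> = "inverse_map \<alpha>" and ?y = "inverse_map (level_perm \<alpha>) x"
  have \<beta>: "?\<beta> \<in> tree_auts"
    by (rule inverse_tree_aut[OF assms])
  have c: "?\<beta> \<circ> \<alpha> = id" "\<alpha> \<circ> ?\<beta> = id"
    using assms by (simp_all add: tree_autD(1))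
  have "level_perm \<alpha> \<circ> level_perm ?\<beta> = id"
    using level_perm_comp(1)[OF assms \<beta>] c by simp
  then show p: "level_perm ?\<beta> = inverse_map (level_perm \<alpha>)"
    using tree_aut_node(1)[OF assms] by (metis comp_assoc id_comp comp_id inverse_map_comp(1))
  have "tree_state \<alpha> ?y \<circ> tree_state ?\<beta> x = id"
    using level_perm_comp(2)[OF assms \<beta>, of x] c p by simp
  then show "tree_state ?\<beta> x = inverse_map (tree_state \<alpha> ?y)"
    using tree_autD(1)[OF tree_aut_node(2)[OF assms]]
    by (metis comp_assoc id_comp comp_id inverse_map_comp(1))
qed

lemma agree_Suc_iff:
  assumes "\<alpha> \<in> tree_auts" "\<beta> \<in> tree_auts"
  shows "agree (Suc n) \<alpha> \<beta> \<longleftrightarrow>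
    level_perm \<alpha> = level_perm \<beta> \<and> (\<forall>x. agree n (tree_state \<alpha> x) (tree_state \<beta> x))"
proof
  assume a: "agree (Suc n) \<alpha> \<beta>"
  have "\<alpha> [x] = \<beta> [x]" for x
    using agree_le[OF assms a] by simp
  then have "level_perm \<alpha> = level_perm \<beta>"
    by (auto simp: level_perm_def)
  moreover have "tree_state \<alpha> x w = tree_state \<beta> x w" if "length w = n" for x w
    using a that by (simp add: tree_state_def agree_def)
  ultimately show "level_perm \<alpha> = level_perm \<beta> \<and> (\<forall>x. agree n (tree_state \<alpha> x) (tree_state \<beta> x))"
    by (simp add: agree_def)
next
  assume "level_perm \<alpha> = level_perm \<beta> \<and> (\<forall>x. agree n (tree_state \<alpha> x) (tree_state \<beta> x))"
  then have "\<alpha> w = \<beta> w" if "length w = Suc n" for w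
    using that tree_aut_Cons[OF assms(1)] tree_aut_Cons[OF assms(2)]
    by (cases w) (auto simp: agree_def)
  then show "agree (Suc n) \<alpha> \<beta>"
    by (simp add: agree_def)
qed


section \<open>Homomorphisms between groups of tree automorphisms\<close>

lemma inverse_map_unique:
  assumes "\<beta> \<circ> \<alpha> = id" "bij \<alpha>"
  shows "\<beta> = inverse_map \<alpha>"
  using assms by (metis comp_assoc comp_id id_comp inverse_map_comp(2))

lemma hom_inverse:
  assumes "\<And>\<alpha> \<beta>. \<alpha> \<in> tree_auts \<Longrightarrow> \<beta> \<in> tree_auts \<Longrightarrow> \<phi> (\<alpha> \<circ> \<beta>) = \<phi> \<alpha> \<circ> \<phi> \<beta>"
    and "\<phi> id = id" and "\<And>\<alpha>. \<alpha> \<in> tree_auts \<Longrightarrow> \<phi> \<alpha> \<in> tree_auts" and "\<alpha> \<in> tree_auts"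
  shows "\<phi> (inverse_map \<alpha>) = inverse_map (\<phi> \<alpha>)"
proof (rule inverse_map_unique)
  show "\<phi> (inverse_map \<alpha>) \<circ> \<phi> \<alpha> = id"
    using assms(1)[OF inverse_tree_aut[OF assms(4)] assms(4)] assms(2) tree_autD(1)[OF assms(4)] by simp
  show "bij (\<phi> \<alpha>)"
    using tree_autD(1) assms(3,4) by blast
qed

lemma subgroup_preimage:
  assumes hom: "\<And>\<alpha> \<beta>. \<alpha> \<in> tree_auts \<Longrightarrow> \<beta> \<in> tree_auts \<Longrightarrow> \<phi> (\<alpha> \<circ> \<beta>) = \<phi> \<alpha> \<circ> \<phi> \<beta>"
    and one: "\<phi> id = id" and aut: "\<And>\<alpha>. \<alpha> \<in> tree_auts \<Longrightarrow> \<phi> \<alpha> \<in> tree_auts"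
    and H: "subgroup H tree_Aut"
  shows "subgroup {\<alpha> \<in> tree_auts. \<phi> \<alpha> \<in> H} tree_Aut"
  unfolding subgroup_tree_Aut_iff
proof (intro conjI ballI)
  note [simp] = subgroup_tree_AutD[OF H]
  show "id \<in> {\<alpha> \<in> tree_auts. \<phi> \<alpha> \<in> H}"
    by (simp add: one)
  show "\<alpha> \<circ> \<beta> \<in> {\<alpha> \<in> tree_auts. \<phi> \<alpha> \<in> H}"
    if "\<alpha> \<in> {\<alpha> \<in> tree_auts. \<phi> \<alpha> \<in> H}" "\<beta> \<in> {\<alpha> \<in> tree_auts. \<phi> \<alpha> \<in> H}" for \<alpha> \<beta>
    using that by (simp add: comp_tree_aut hom)
  show "inverse_map \<alpha> \<in> {\<alpha> \<in> tree_auts. \<phi> \<alpha> \<in> H}" if "\<alpha> \<in> {\<alpha> \<in> tree_auts. \<phi> \<alpha> \<in> H}" for \<alpha>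
    using that hom_inverse[of \<phi>, OF hom one aut] by (simp add: inverse_tree_aut)
qed auto

definition commutator :: "('b \<Rightarrow> 'b) \<Rightarrow> ('b \<Rightarrow> 'b) \<Rightarrow> 'b \<Rightarrow> 'b" where
  "commutator \<alpha> \<beta> = \<alpha> \<circ> \<beta> \<circ> inverse_map \<alpha> \<circ> inverse_map \<beta>"

lemma hom_commutator:
  assumes hom: "\<And>\<alpha> \<beta>. \<alpha> \<in> tree_auts \<Longrightarrow> \<beta> \<in> tree_auts \<Longrightarrow> \<phi> (\<alpha> \<circ> \<beta>) = \<phi> \<alpha> \<circ> \<phi> \<beta>"
    and one: "\<phi> id = id" and aut: "\<And>\<alpha>. \<alpha> \<in> tree_auts \<Longrightarrow> \<phi> \<alpha> \<in> tree_auts"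
    and "\<alpha> \<in> tree_auts" "\<beta> \<in> tree_auts"
  shows "\<phi> (commutator \<alpha> \<beta>) = commutator (\<phi> \<alpha>) (\<phi> \<beta>)"
  using assms(4,5) hom_inverse[of \<phi>, OF hom one aut]
  by (simp add: commutator_def hom comp_tree_aut inverse_tree_aut)

lemma commutator_mem:
  assumes "subgroup H tree_Aut" "\<alpha> \<in> H" "\<beta> \<in> H"
  shows "commutator \<alpha> \<beta> \<in> H"
  using assms(2,3) subgroup_tree_AutD[OF assms(1)] by (simp add: commutator_def)

text \<open>
  The form in which perfectness is applied: the subgroup \<open>H\<close> is usually the preimage of a group under a
  homomorphism, and then a whole copy of \<open>G\<close> is obtained from commutators alone.
\<close>

lemma perfect_group_subset:
  assumes G: "subgroup G tree_Aut" "perfect_group (aut_group G)" and H: "subgroup H tree_Aut"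
    and comm: "\<And>\<alpha> \<beta>. \<alpha> \<in> G \<Longrightarrow> \<beta> \<in> G \<Longrightarrow> commutator \<alpha> \<beta> \<in> H"
  shows "G \<subseteq> H"
proof -
  interpret A: group "aut_group G"
    by (rule group.subgroup_imp_group[OF group_tree_Aut G(1)])
  note G' = subgroup_tree_AutD[OF G(1)]
  have eq: "\<alpha> \<otimes>\<^bsub>aut_group G\<^esub> \<beta> \<otimes>\<^bsub>aut_group G\<^esub> inv\<^bsub>aut_group G\<^esub> \<alpha> \<otimes>\<^bsub>aut_group G\<^esub> inv\<^bsub>aut_group G\<^esub> \<beta>
      = commutator \<alpha> \<beta>" if "\<alpha> \<in> G" "\<beta> \<in> G" for \<alpha> \<beta>
    using that group.m_inv_consistent[OF group_tree_Aut G(1)] G'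
    by (simp add: commutator_def comp_tree_aut inverse_tree_aut)
  have D: "derived_set (aut_group G) (carrier (aut_group G)) \<subseteq> H"
    using eq comm by auto
  have D': "derived_set (aut_group G) (carrier (aut_group G)) \<subseteq> G"
    using A.derived_set_in_carrier[of "carrier (aut_group G)"] by simp
  have "G = generate (aut_group G) (derived_set (aut_group G) (carrier (aut_group G)))"
    using G(2) by (simp add: perfect_group_def derived_def)
  also have "\<dots> = generate tree_Aut (derived_set (aut_group G) (carrier (aut_group G)))"
    by (rule group.generate_consistent[OF group_tree_Aut D' G(1)])
  also have "\<dots> \<subseteq> H"
    by (rule group.generate_subgroup_incl[OF group_tree_Aut D H])
  finally show ?thesis .
qed


section \<open>Automorphisms supported below a vertex\<close>

definition at_letter :: "'a \<Rightarrow> ('a list \<Rightarrow> 'a list) \<Rightarrow> 'a list \<Rightarrow> 'a list" where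
  "at_letter x \<alpha> = tree_node id (\<lambda>y. if y = x then \<alpha> else id)"

lemma at_letter_tree_aut:
  fixes x :: "'a::finite"
  shows "\<alpha> \<in> tree_auts \<Longrightarrow> at_letter x \<alpha> \<in> tree_auts"
  by (simp add: at_letter_def tree_node_tree_aut_iff)

lemma at_letter_id: "at_letter x id = id"
  by (simp add: at_letter_def cong: if_cong)

lemma tree_node_cong:
  "q = q' \<Longrightarrow> (\<And>x. h x = h' x) \<Longrightarrow> tree_node q h = tree_node q' h'"
  by (metis ext)

lemma at_letter_comp: "at_letter x (\<alpha> \<circ> \<beta>) = at_letter x \<alpha> \<circ> at_letter x \<beta>"
  unfolding at_letter_def tree_node_comp by (rule tree_node_cong) auto

lemmas at_letter_hom = at_letter_comp at_letter_id at_letter_tree_aut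

text \<open>
  The argument of the left-hand side is conjugated in advance, so that a given \<open>\<beta>\<close> below the letter
  \<open>level_perm \<alpha> x\<close> is reached; any group that contains the states of \<open>\<alpha>\<close> absorbs this correction.
\<close>

lemma conj_at_letter:
  fixes x :: "'a::finite"
  assumes \<alpha>: "\<alpha> \<in> tree_auts"
  shows "\<alpha> \<circ> at_letter x (inverse_map (tree_state \<alpha> x) \<circ> \<beta> \<circ> tree_state \<alpha> x) \<circ> inverse_map \<alpha> =
    at_letter (level_perm \<alpha> x) \<beta>"
proof -
  let ?q = "level_perm \<alpha>" and ?s = "tree_state \<alpha>"
  have q: "bij ?q" and s: "\<And>y. bij (?s y)"
    using tree_aut_node[OF \<alpha>] tree_autD(1) by auto
  have "\<alpha> \<circ> at_letter x (inverse_map (?s x) \<circ> \<beta> \<circ> ?s x) =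
      tree_node ?q ?s \<circ> at_letter x (inverse_map (?s x) \<circ> \<beta> \<circ> ?s x)"
    by (simp add: tree_node_eq[OF \<alpha>])
  also have "\<dots> = at_letter (?q x) \<beta> \<circ> tree_node ?q ?s"
    unfolding at_letter_def tree_node_comp
  proof (rule tree_node_cong)
    fix y
    have "?s x \<circ> (inverse_map (?s x) \<circ> \<beta> \<circ> ?s x) = \<beta> \<circ> ?s x"
      using inverse_map_comp(2)[OF s[of x]] by (simp add: comp_assoc[symmetric])
    moreover have "?q y = ?q x \<longleftrightarrow> y = x"
      using q by (auto simp: bij_def dest: injD)
    ultimately show "?s (id y) \<circ> (if y = x then inverse_map (?s x) \<circ> \<beta> \<circ> ?s x else id) =
        (if ?q y = ?q x then \<beta> else id) \<circ> ?s y"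
      by simp
  qed simp
  finally show ?thesis
    using tree_autD(1)[OF \<alpha>] by (simp add: tree_node_eq[OF \<alpha>] comp_assoc)
qed

primrec at_vertex :: "'a list \<Rightarrow> ('a list \<Rightarrow> 'a list) \<Rightarrow> 'a list \<Rightarrow> 'a list" where
  "at_vertex [] \<alpha> = \<alpha>"
| "at_vertex (x # v) \<alpha> = at_letter x (at_vertex v \<alpha>)"

lemma at_vertex_tree_aut:
  fixes v :: "'a::finite list"
  shows "\<alpha> \<in> tree_auts \<Longrightarrow> at_vertex v \<alpha> \<in> tree_auts"
  by (induction v) (auto simp: at_letter_tree_aut)

lemma at_vertex_id: "at_vertex v id = id"
  by (induction v) (simp_all only: at_vertex.simps at_letter_id)

lemma at_vertex_comp: "at_vertex v (\<alpha> \<circ> \<beta>) = at_vertex v \<alpha> \<circ> at_vertex v \<beta>"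
  by (induction v) (simp_all only: at_vertex.simps at_letter_comp)

lemmas at_vertex_hom = at_vertex_comp at_vertex_id at_vertex_tree_aut

lemma at_vertex_off_support:
  assumes "take (length v) w \<noteq> v"
  shows "at_vertex v \<alpha> w = w"
  using assms
proof (induction v arbitrary: w)
  case (Cons x v)
  then show ?case
    by (cases w) (auto simp: at_letter_def)
qed simp

lemma at_vertex_on_support:
  assumes "\<alpha> \<in> tree_auts" "take (length v) w = v"
  shows "take (length v) (at_vertex v \<alpha> w) = v"
  using assms(2)
proof (induction v arbitrary: w)
  case (Cons x v)
  then show ?case
    by (cases w) (auto simp: at_letter_def)
qed simp

text \<open>
  The conjugate is supported below \<open>\<nu> v\<close>. As \<open>\<nu> v\<close> and \<open>v\<close> are different words of the same length, the
  two subtrees are disjoint.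
\<close>

lemma conj_at_vertex_commutes:
  fixes v :: "'a::finite list"
  assumes \<nu>: "\<nu> \<in> tree_auts" and moved: "\<nu> v \<noteq> v" and f: "f \<in> tree_auts" and h: "h \<in> tree_auts"
  shows "(\<nu> \<circ> at_vertex v f \<circ> inverse_map \<nu>) \<circ> at_vertex v h = at_vertex v h \<circ> (\<nu> \<circ> at_vertex v f \<circ> inverse_map \<nu>)"
proof
  let ?a = "\<nu> \<circ> at_vertex v f \<circ> inverse_map \<nu>" and ?n = "length v"
  have b: "bij \<nu>"
    by (rule tree_autD(1)[OF \<nu>])
  have prefix: "take ?n (\<nu> u) = \<nu> v" if "take ?n u = v" for u
    using tree_aut_take[OF \<nu>, of v "drop ?n u"] that by (metis append_take_drop_id)
  have prefix': "take ?n (inverse_map \<nu> u) = v" if "take ?n u = \<nu> v" for u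
  proof -
    have "take (length (\<nu> v)) (inverse_map \<nu> (\<nu> v @ drop ?n u)) = inverse_map \<nu> (\<nu> v)"
      by (rule tree_aut_take[OF inverse_tree_aut[OF \<nu>]])
    moreover have "u = \<nu> v @ drop ?n u"
      using that by (metis append_take_drop_id)
    ultimately show ?thesis
      using b tree_aut_length(1)[OF \<nu>, of v] by simp
  qed
  have off: "?a u = u" if "take ?n u \<noteq> \<nu> v" for u
  proof -
    have "take ?n (inverse_map \<nu> u) \<noteq> v"
      using prefix[of "inverse_map \<nu> u"] that b by auto
    then show ?thesis
      using b by (simp add: at_vertex_off_support)
  qed
  have on: "take ?n (?a u) = \<nu> v" if "take ?n u = \<nu> v" for u
    using prefix[OF at_vertex_on_support[OF f prefix'[OF that]]] by simp
  fix u
  show "(?a \<circ> at_vertex v h) u = (at_vertex v h \<circ> ?a) u"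
  proof (cases "take ?n u = v")
    case True
    then have "?a u = u" "?a (at_vertex v h u) = at_vertex v h u"
      using moved at_vertex_on_support[OF h True] by (intro off, simp)+
    then show ?thesis
      by simp
  next
    case False
    then have u: "at_vertex v h u = u"
      by (rule at_vertex_off_support)
    have "take ?n (?a u) \<noteq> v"
      using on[of u] off[of u] moved False by metis
    then have "at_vertex v h (?a u) = ?a u"
      by (rule at_vertex_off_support)
    then show ?thesis
      using u by simp
  qed
qed

text \<open>
  An automorphism that fixes the first level is the product of its states, each placed below its own
  letter; there are finitely many letters.
\<close>

lemma tree_node_id_mem:
  fixes h :: "'a::finite \<Rightarrow> 'a list \<Rightarrow> 'a list"
  assumes H: "subgroup H tree_Aut" and h: "\<And>x. at_letter x (h x) \<in> H"
  shows "tree_node id h \<in> H"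
proof -
  have "tree_node id (\<lambda>x. if x \<in> S then h x else id) \<in> H" if "finite S" for S
    using that
  proof induction
    case empty
    then show ?case
      using subgroup_tree_AutD(2)[OF H] by (simp only: empty_iff if_False tree_node_id)
  next
    case (insert y S)
    have "tree_node id (\<lambda>x. if x \<in> insert y S then h x else id) =
        at_letter y (h y) \<circ> tree_node id (\<lambda>x. if x \<in> S then h x else id)"
      unfolding at_letter_def tree_node_comp using insert.hyps by (intro tree_node_cong) auto
    then show ?case
      using subgroup_tree_AutD(3)[OF H h insert.IH, of y] by (simp only:)
  qed
  from this[of UNIV] show ?thesis
    by simp
qed

section \<open>The automorphisms along a sequence of letters\<close>

lemma tilde_node:
  "tilde b \<alpha> \<omega> = tree_node id
     (\<lambda>x. if x = b then tilde b \<alpha> (seq_shift \<omega>) else if x = \<omega> 0 then \<alpha> else id)"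
proof
  show "tilde b \<alpha> \<omega> w = tree_node id
     (\<lambda>x. if x = b then tilde b \<alpha> (seq_shift \<omega>) else if x = \<omega> 0 then \<alpha> else id) w" for w
    by (cases w) auto
qed

lemma tilde_id: "tilde b id \<omega> = id"
proof
  show "tilde b id \<omega> w = id w" for w
    by (induction w arbitrary: \<omega>) auto
qed

lemma tilde_comp: "tilde b (\<alpha> \<circ> \<beta>) \<omega> = tilde b \<alpha> \<omega> \<circ> tilde b \<beta> \<omega>"
proof
  show "tilde b (\<alpha> \<circ> \<beta>) \<omega> w = (tilde b \<alpha> \<omega> \<circ> tilde b \<beta> \<omega>) w" for w
    by (induction w arbitrary: \<omega>) auto
qed

text \<open>
  The recursion never ends below the letter \<open>b\<close>, but it may be cut off at any depth by an arbitrary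
  automorphism.
\<close>

lemma tilde_tree_aut:
  fixes b :: "'a::finite"
  assumes "\<alpha> \<in> tree_auts"
  shows "tilde b \<alpha> \<omega> \<in> tree_auts"
proof (rule tree_aut_levelwiseI)
  fix n
  show "\<exists>\<beta>\<in>tree_auts. \<forall>w. length w \<le> n \<longrightarrow> tilde b \<alpha> \<omega> w = \<beta> w"
  proof (induction n arbitrary: \<omega>)
    case 0
    then show ?case
      by (intro bexI[of _ id]) auto
  next
    case (Suc n)
    obtain \<beta> where \<beta>: "\<beta> \<in> tree_auts" "\<forall>w. length w \<le> n \<longrightarrow> tilde b \<alpha> (seq_shift \<omega>) w = \<beta> w"
      using Suc.IH by blast
    let ?\<beta>' = "tree_node id (\<lambda>x. if x = b then \<beta> else if x = \<omega> 0 then \<alpha> else id)"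
    have "?\<beta>' \<in> tree_auts"
      using \<beta>(1) assms by (simp add: tree_node_tree_aut_iff)
    moreover have "tilde b \<alpha> \<omega> w = ?\<beta>' w" if "length w \<le> Suc n" for w
      using that \<beta>(2) by (cases w) auto
    ultimately show ?case
      by blast
  qed
qed

lemmas tilde_hom = tilde_comp tilde_id tilde_tree_aut

lemma tilde_split:
  assumes "\<omega> 0 \<noteq> b"
  shows "tilde b \<alpha> \<omega> = at_letter b (tilde b \<alpha> (seq_shift \<omega>)) \<circ> at_letter (\<omega> 0) \<alpha>"
proof -
  have "at_letter b (tilde b \<alpha> (seq_shift \<omega>)) \<circ> at_letter (\<omega> 0) \<alpha> = tree_node id
     (\<lambda>x. if x = b then tilde b \<alpha> (seq_shift \<omega>) else if x = \<omega> 0 then \<alpha> else id)"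
    unfolding at_letter_def tree_node_comp using assms by (intro tree_node_cong) auto
  then show ?thesis
    using tilde_node[of b \<alpha> \<omega>] by simp
qed


section \<open>Self-similarity and the first-level decomposition of the generated groups\<close>

locale perfect_self_similar =
  fixes b :: "'a::finite" and G :: "('a list \<Rightarrow> 'a list) set"
  assumes subgroup_G: "subgroup G tree_Aut"
    and perfect_G: "perfect_group (aut_group G)"
    and self_similar_G: "self_similar G"
    and property_H_G: "property_H G"
begin

lemmas G_aut = subgroup_tree_AutD(5)[OF subgroup_G]
  and G_comp = subgroup_tree_AutD(3)[OF subgroup_G]
  and G_inverse = subgroup_tree_AutD(4)[OF subgroup_G]
  and G_id = subgroup_tree_AutD(2)[OF subgroup_G]

lemma G_state: "g \<in> G \<Longrightarrow> tree_state g x \<in> G"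
  using self_similar_G by (auto simp: self_similar_def)

definition spines :: "(nat \<Rightarrow> 'a) set \<Rightarrow> bool" where
  "spines \<Omega> \<longleftrightarrow> \<Omega> \<subseteq> letter_seqs b \<and> \<Omega> \<noteq> {}"

lemma spines_shift: "spines \<Omega> \<Longrightarrow> spines (seq_shift ` \<Omega>)"
  by (auto simp: spines_def letter_seqs_def seq_shift_def)

lemma Gamma_subgroup: "subgroup (Gamma b G \<Omega>) tree_Aut"
  unfolding Gamma_def
  by (rule group.generate_is_subgroup[OF group_tree_Aut]) (auto simp: G_aut tilde_tree_aut)

lemmas Gamma_aut = subgroup_tree_AutD(5)[OF Gamma_subgroup]
  and Gamma_comp = subgroup_tree_AutD(3)[OF Gamma_subgroup]
  and Gamma_inverse = subgroup_tree_AutD(4)[OF Gamma_subgroup]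
  and Gamma_id = subgroup_tree_AutD(2)[OF Gamma_subgroup]

lemma Gamma_incl: "g \<in> G \<Longrightarrow> g \<in> Gamma b G \<Omega>"
  and Gamma_tilde: "g \<in> G \<Longrightarrow> \<omega> \<in> \<Omega> \<Longrightarrow> tilde b g \<omega> \<in> Gamma b G \<Omega>"
  unfolding Gamma_def by (rule generate.incl; blast)+

lemma Gamma_least:
  assumes "subgroup H tree_Aut" "G \<subseteq> H" "\<And>g \<omega>. g \<in> G \<Longrightarrow> \<omega> \<in> \<Omega> \<Longrightarrow> tilde b g \<omega> \<in> H"
  shows "Gamma b G \<Omega> \<subseteq> H"
  unfolding Gamma_def
  by (rule group.generate_subgroup_incl[OF group_tree_Aut _ assms(1)]) (use assms(2,3) in auto)

text \<open>
  The group is generated by \<open>G\<close> and its homomorphic images under \<open>g \<mapsto> tilde b g \<omega>\<close>, and images of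
  perfect groups are perfect. The conclusion is stated in the same form as for \<open>G\<close>.
\<close>

lemma Gamma_perfect:
  assumes H: "subgroup H tree_Aut"
    and comm: "\<And>\<alpha> \<beta>. \<alpha> \<in> Gamma b G \<Omega> \<Longrightarrow> \<beta> \<in> Gamma b G \<Omega> \<Longrightarrow> commutator \<alpha> \<beta> \<in> H"
  shows "Gamma b G \<Omega> \<subseteq> H"
proof (rule Gamma_least[OF H])
  show "G \<subseteq> H"
    using comm Gamma_incl by (intro perfect_group_subset[OF subgroup_G perfect_G H]) blast
  fix g \<omega> assume "g \<in> G" "\<omega> \<in> \<Omega>"
  have "G \<subseteq> {\<alpha> \<in> tree_auts. tilde b \<alpha> \<omega> \<in> H}"
  proof (rule perfect_group_subset[OF subgroup_G perfect_G])
    show "subgroup {\<alpha> \<in> tree_auts. tilde b \<alpha> \<omega> \<in> H} tree_Aut"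
      by (rule subgroup_preimage[OF tilde_hom H])
    fix \<alpha> \<beta> assume \<alpha>\<beta>: "\<alpha> \<in> G" "\<beta> \<in> G"
    have "tilde b (commutator \<alpha> \<beta>) \<omega> = commutator (tilde b \<alpha> \<omega>) (tilde b \<beta> \<omega>)"
      by (rule hom_commutator[of "\<lambda>\<alpha>. tilde b \<alpha> \<omega>", OF tilde_hom G_aut[OF \<alpha>\<beta>(1)] G_aut[OF \<alpha>\<beta>(2)]])
    then have "tilde b (commutator \<alpha> \<beta>) \<omega> \<in> H"
      using comm[OF Gamma_tilde[OF \<alpha>\<beta>(1) \<open>\<omega> \<in> \<Omega>\<close>] Gamma_tilde[OF \<alpha>\<beta>(2) \<open>\<omega> \<in> \<Omega>\<close>]] by simp
    moreover have "commutator \<alpha> \<beta> \<in> tree_auts"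
      using commutator_mem[OF subgroup_G \<alpha>\<beta>] by (rule G_aut)
    ultimately show "commutator \<alpha> \<beta> \<in> {\<alpha> \<in> tree_auts. tilde b \<alpha> \<omega> \<in> H}"
      by simp
  qed
  then show "tilde b g \<omega> \<in> H"
    using \<open>g \<in> G\<close> by blast
qed

lemma tree_node_id_inverse:
  fixes s :: "'a \<Rightarrow> 'a list \<Rightarrow> 'a list"
  assumes "\<And>x. s x \<in> tree_auts"
  shows "inverse_map (tree_node id s) = tree_node id (\<lambda>x. inverse_map (s x))"
proof (rule inverse_map_unique[symmetric])
  show "tree_node id (\<lambda>x. inverse_map (s x)) \<circ> tree_node id s = id"
    using assms by (simp add: tree_node_comp tree_autD(1))
  show "bij (tree_node id s)"
    by (rule tree_autD(1)) (simp add: tree_node_tree_aut_iff assms)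
qed

lemma tree_node_id_commutator:
  fixes s t :: "'a \<Rightarrow> 'a list \<Rightarrow> 'a list"
  assumes "\<And>x. s x \<in> tree_auts" "\<And>x. t x \<in> tree_auts"
  shows "commutator (tree_node id s) (tree_node id t) = tree_node id (\<lambda>x. commutator (s x) (t x))"
  using assms by (simp add: commutator_def tree_node_id_inverse tree_node_comp)

text \<open>
  The step that uses property H. The generator for \<open>g\<close> has non-trivial states only at \<open>b\<close> and at the
  first letter \<open>c\<close> of \<open>\<omega>\<close>. Conjugating another generator by an \<open>a\<close> that fixes \<open>c\<close> but not \<open>b\<close> moves
  its state at \<open>b\<close> elsewhere, so that the two have only \<open>c\<close> in common and their commutator is
  supported below \<open>c\<close>.
\<close>

lemma at_first_letter_G:
  assumes \<omega>: "\<omega> \<in> \<Omega>" "\<omega> 0 \<noteq> b" and g: "g \<in> G"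
  shows "at_letter (\<omega> 0) g \<in> Gamma b G \<Omega>"
proof -
  let ?\<Gamma> = "Gamma b G \<Omega>" and ?c = "\<omega> 0"
  obtain a where a: "a \<in> G" "level_perm a ?c = ?c" "level_perm a b \<noteq> b"
    using property_H_G \<omega>(2) unfolding property_H_def by metis
  let ?p = "level_perm a" and ?s = "tree_state a"
  have p: "bij ?p"
    by (rule tree_aut_node(1)[OF G_aut[OF a(1)]])
  have s: "\<And>x. ?s x \<in> G"
    by (rule G_state[OF a(1)])
  have "G \<subseteq> {\<alpha> \<in> tree_auts. at_letter ?c \<alpha> \<in> ?\<Gamma>}"
  proof (rule perfect_group_subset[OF subgroup_G perfect_G])
    show "subgroup {\<alpha> \<in> tree_auts. at_letter ?c \<alpha> \<in> ?\<Gamma>} tree_Aut"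
      by (rule subgroup_preimage[OF at_letter_hom Gamma_subgroup])
    fix g h assume g: "g \<in> G" and h: "h \<in> G"
    \<comment> \<open>chosen so that the conjugate of its generator by \<open>a\<close> has state \<open>h\<close> at the first letter\<close>
    define k where "k = inverse_map (?s ?c) \<circ> h \<circ> ?s ?c"
    have k: "k \<in> G"
      unfolding k_def by (intro G_comp G_inverse s h)
    \<comment> \<open>the states of the generator for \<open>\<alpha>\<close>, and of the conjugate of the generator for \<open>k\<close>\<close>
    define \<tau> where "\<tau> = (\<lambda>\<alpha> x. if x = b then tilde b \<alpha> (seq_shift \<omega>) else if x = ?c then \<alpha> else id)"
    have \<tau>: "\<tau> \<alpha> x \<in> tree_auts" if "\<alpha> \<in> G" for \<alpha> x
      using G_aut[OF that] by (simp add: \<tau>_def tilde_tree_aut)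
    define \<kappa> where "\<kappa> x = ?s (inverse_map ?p x) \<circ> \<tau> k (inverse_map ?p x) \<circ> inverse_map (?s (inverse_map ?p x))" for x
    have \<kappa>: "\<kappa> x \<in> tree_auts" for x
      unfolding \<kappa>_def by (intro comp_tree_aut inverse_tree_aut \<tau>[OF k] G_aut[OF s])
    have conj: "a \<circ> tilde b k \<omega> \<circ> inverse_map a = tree_node id \<kappa>"
    proof -
      have "inverse_map a = tree_node (inverse_map ?p) (\<lambda>x. inverse_map (?s (inverse_map ?p x)))"
        using tree_node_eq[OF inverse_tree_aut[OF G_aut[OF a(1)]]] level_perm_inverse[OF G_aut[OF a(1)]]
        by (metis (no_types, lifting) tree_node_cong)
      moreover have "a = tree_node ?p ?s"
        by (rule tree_node_eq[OF G_aut[OF a(1)], symmetric])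
      moreover have "tilde b k \<omega> = tree_node id (\<tau> k)"
        unfolding \<tau>_def by (rule tilde_node)
      ultimately have "a \<circ> tilde b k \<omega> \<circ> inverse_map a =
          tree_node ?p ?s \<circ> tree_node id (\<tau> k) \<circ> tree_node (inverse_map ?p) (\<lambda>x. inverse_map (?s (inverse_map ?p x)))"
        by metis
      then show ?thesis
        using p by (simp add: tree_node_comp \<kappa>_def[abs_def])
    qed
    have \<kappa>_c: "\<kappa> ?c = h"
    proof -
      have "inverse_map ?p ?c = ?c"
        using inverse_map_apply(1)[OF p, of ?c] a(2) by simp
      then have "\<kappa> ?c = ?s ?c \<circ> k \<circ> inverse_map (?s ?c)"
        using \<omega>(2) by (simp add: \<kappa>_def \<tau>_def)
      then show ?thesis
        using tree_autD(1)[OF G_aut[OF s]] by (simp add: k_def fun_eq_iff)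
    qed
    have \<kappa>_b: "\<kappa> b = id"
    proof -
      have "inverse_map ?p b \<noteq> b" "inverse_map ?p b \<noteq> ?c"
        using inverse_map_apply(2)[OF p, of b] a(2,3) \<omega>(2) by metis+
      then show ?thesis
        using tree_autD(1)[OF G_aut[OF s]] by (simp add: \<kappa>_def \<tau>_def)
    qed
    have triv: "commutator id \<alpha> = id" "commutator \<alpha> id = id" if "bij \<alpha>" for \<alpha> :: "'a list \<Rightarrow> 'a list"
      using that by (simp_all add: commutator_def inv_id)
    have "commutator (tilde b g \<omega>) (a \<circ> tilde b k \<omega> \<circ> inverse_map a) = commutator (tree_node id (\<tau> g)) (tree_node id \<kappa>)"
      unfolding conj \<tau>_def by (subst tilde_node) simp
    also have "\<dots> = tree_node id (\<lambda>x. commutator (\<tau> g x) (\<kappa> x))"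
      by (rule tree_node_id_commutator[OF \<tau>[OF g] \<kappa>])
    also have "\<dots> = at_letter ?c (commutator g h)"
      unfolding at_letter_def
    proof (rule tree_node_cong)
      show "commutator (\<tau> g x) (\<kappa> x) = (if x = ?c then commutator g h else id)" for x
        using \<omega>(2) \<kappa>_c \<kappa>_b triv tree_autD(1)[OF \<kappa>] tree_autD(1)[OF tilde_tree_aut[OF G_aut[OF g]]]
        by (cases "x = b"; cases "x = ?c") (auto simp: \<tau>_def)
    qed simp
    finally have "at_letter ?c (commutator g h) = commutator (tilde b g \<omega>) (a \<circ> tilde b k \<omega> \<circ> inverse_map a)" ..
    moreover have "commutator (tilde b g \<omega>) (a \<circ> tilde b k \<omega> \<circ> inverse_map a) \<in> ?\<Gamma>"
      by (intro commutator_mem[OF Gamma_subgroup] Gamma_comp Gamma_inverse Gamma_tilde Gamma_incl g k a(1) \<omega>(1))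
    moreover have "commutator g h \<in> tree_auts"
      using commutator_mem[OF subgroup_G g h] by (rule G_aut)
    ultimately show "commutator g h \<in> {\<alpha> \<in> tree_auts. at_letter ?c \<alpha> \<in> ?\<Gamma>}"
      by simp
  qed
  with g show ?thesis
    by blast
qed

text \<open>
  Conjugation by an element of \<open>G\<close> that sends \<open>x\<close> to \<open>y\<close> changes the state only by a conjugation inside
  \<open>K\<close>, since by self-similarity the states of \<open>G\<close> are in \<open>G \<subseteq> K\<close>.
\<close>

lemma at_letter_transport:
  assumes "subgroup K tree_Aut" "G \<subseteq> K" and mem: "\<And>\<beta>. \<beta> \<in> K \<Longrightarrow> at_letter x \<beta> \<in> Gamma b G \<Omega>"
    and "\<beta> \<in> K"
  shows "at_letter y \<beta> \<in> Gamma b G \<Omega>"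
proof -
  obtain k where k: "k \<in> G" "level_perm k x = y"
    using property_H_G unfolding property_H_def by metis
  have s: "tree_state k x \<in> K"
    using G_state[OF k(1)] assms(2) by blast
  have "inverse_map (tree_state k x) \<circ> \<beta> \<circ> tree_state k x \<in> K"
    using s assms(4) subgroup_tree_AutD(3,4)[OF assms(1)] by blast
  then have "k \<circ> at_letter x (inverse_map (tree_state k x) \<circ> \<beta> \<circ> tree_state k x) \<circ> inverse_map k \<in> Gamma b G \<Omega>"
    by (intro Gamma_comp Gamma_inverse Gamma_incl k(1) mem)
  then show ?thesis
    by (simp add: conj_at_letter[OF G_aut[OF k(1)]] k(2))
qed

lemma at_letter_G:
  assumes "spines \<Omega>" "g \<in> G"
  shows "at_letter x g \<in> Gamma b G \<Omega>"
proof -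
  obtain \<omega> where \<omega>: "\<omega> \<in> \<Omega>" "\<omega> 0 \<noteq> b"
    using assms(1) by (auto simp: spines_def letter_seqs_def)
  show ?thesis
    using at_letter_transport[OF subgroup_G order_refl at_first_letter_G[OF \<omega>] assms(2)] .
qed

text \<open>
  Removing the part below the first letter of \<open>\<omega>\<close> from \<open>tilde b g \<omega>\<close> leaves \<open>tilde b g (seq_shift \<omega>)\<close>
  placed below \<open>b\<close>, so the letter \<open>b\<close> is the one at which the shifted generators show up directly.
\<close>

lemma at_letter_Gamma:
  assumes \<Omega>: "spines \<Omega>" and \<beta>: "\<beta> \<in> Gamma b G (seq_shift ` \<Omega>)"
  shows "at_letter x \<beta> \<in> Gamma b G \<Omega>"
proof (rule at_letter_transport[OF Gamma_subgroup _ _ \<beta>])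
  show "G \<subseteq> Gamma b G (seq_shift ` \<Omega>)"
    using Gamma_incl by blast
  have "Gamma b G (seq_shift ` \<Omega>) \<subseteq> {\<alpha> \<in> tree_auts. at_letter b \<alpha> \<in> Gamma b G \<Omega>}"
  proof (rule Gamma_least)
    show "subgroup {\<alpha> \<in> tree_auts. at_letter b \<alpha> \<in> Gamma b G \<Omega>} tree_Aut"
      by (rule subgroup_preimage[OF at_letter_hom Gamma_subgroup])
    show "G \<subseteq> {\<alpha> \<in> tree_auts. at_letter b \<alpha> \<in> Gamma b G \<Omega>}"
      using at_letter_G[OF \<Omega>] G_aut by blast
    fix g \<omega>' assume g: "g \<in> G" and "\<omega>' \<in> seq_shift ` \<Omega>"
    then obtain \<omega> where \<omega>: "\<omega> \<in> \<Omega>" "\<omega>' = seq_shift \<omega>"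
      by blast
    then have ne: "\<omega> 0 \<noteq> b"
      using \<Omega> by (auto simp: spines_def letter_seqs_def)
    have "at_letter b (tilde b g \<omega>') = tilde b g \<omega> \<circ> at_letter (\<omega> 0) (inverse_map g)"
    proof -
      have "at_letter (\<omega> 0) g \<circ> at_letter (\<omega> 0) (inverse_map g) = id"
        using tree_autD(1)[OF G_aut[OF g]] by (simp add: at_letter_comp[symmetric] at_letter_id)
      then show ?thesis
        unfolding tilde_split[of \<omega> b g, OF ne] \<omega>(2) by (simp add: comp_assoc)
    qed
    then have "at_letter b (tilde b g \<omega>') \<in> Gamma b G \<Omega>"
      using Gamma_comp[OF Gamma_tilde[OF g \<omega>(1)] at_letter_G[OF \<Omega> G_inverse[OF g]]] by simp
    then show "tilde b g \<omega>' \<in> {\<alpha> \<in> tree_auts. at_letter b \<alpha> \<in> Gamma b G \<Omega>}"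
      using tilde_tree_aut[OF G_aut[OF g]] by simp
  qed
  then show "at_letter b \<beta> \<in> Gamma b G \<Omega>" if "\<beta> \<in> Gamma b G (seq_shift ` \<Omega>)" for \<beta>
    using that by blast
qed

abbreviation Q where "Q \<equiv> level_perm ` G"

lemma Q_bij: "q \<in> Q \<Longrightarrow> bij q"
  using tree_aut_node(1) G_aut by blast

lemma Q_comp: "q \<in> Q \<Longrightarrow> q' \<in> Q \<Longrightarrow> q \<circ> q' \<in> Q"
  using level_perm_comp(1)[OF G_aut G_aut, symmetric] G_comp by (metis (no_types, lifting) imageE imageI)

text \<open>
  Self-similarity gives one inclusion. For the other, correct \<open>\<alpha>\<close> by an element of \<open>G\<close> with the same
  action on the first level; what is left fixes the first level and is a product of elements placed
  below the letters.
\<close>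

lemma Gamma_iff:
  assumes \<Omega>: "spines \<Omega>"
  shows "\<alpha> \<in> Gamma b G \<Omega> \<longleftrightarrow>
    \<alpha> \<in> tree_auts \<and> level_perm \<alpha> \<in> Q \<and> (\<forall>x. tree_state \<alpha> x \<in> Gamma b G (seq_shift ` \<Omega>))"
proof
  let ?H = "{\<alpha> \<in> tree_auts. level_perm \<alpha> \<in> Q \<and> (\<forall>x. tree_state \<alpha> x \<in> Gamma b G (seq_shift ` \<Omega>))}"
  have "Gamma b G \<Omega> \<subseteq> ?H"
  proof (rule Gamma_least)
    show "subgroup ?H tree_Aut"
      unfolding subgroup_tree_Aut_iff
    proof (intro conjI ballI)
      show "id \<in> ?H"
        using imageI[OF G_id, of level_perm] by (simp add: Gamma_id)
      show "\<alpha> \<circ> \<beta> \<in> ?H" if "\<alpha> \<in> ?H" "\<beta> \<in> ?H" for \<alpha> \<beta>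
        using that by (simp add: comp_tree_aut level_perm_comp Q_comp Gamma_comp)
      show "inverse_map \<alpha> \<in> ?H" if \<alpha>: "\<alpha> \<in> ?H" for \<alpha>
      proof -
        obtain g where g: "g \<in> G" "level_perm \<alpha> = level_perm g"
          using \<alpha> by auto
        then have "level_perm (inverse_map \<alpha>) = level_perm (inverse_map g)"
          using \<alpha> by (simp add: level_perm_inverse(1) G_aut)
        then have "level_perm (inverse_map \<alpha>) \<in> Q"
          using G_inverse[OF g(1)] by simp
        then show ?thesis
          using \<alpha> by (simp add: inverse_tree_aut level_perm_inverse(2) Gamma_inverse)
      qed
    qed auto
    show "G \<subseteq> ?H"
      using G_aut G_state Gamma_incl by auto
    fix g \<omega> assume g: "g \<in> G" and \<omega>: "\<omega> \<in> \<Omega>"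
    have "tilde b g (seq_shift \<omega>) \<in> Gamma b G (seq_shift ` \<Omega>)"
      using Gamma_tilde[OF g] \<omega> by blast
    then have "\<forall>x. tree_state (tilde b g \<omega>) x \<in> Gamma b G (seq_shift ` \<Omega>)"
      using Gamma_incl[OF g] Gamma_id by (subst tilde_node) simp
    moreover have "level_perm (tilde b g \<omega>) = id"
      by (subst tilde_node) simp
    ultimately show "tilde b g \<omega> \<in> ?H"
      using tilde_tree_aut[OF G_aut[OF g]] imageI[OF G_id, of level_perm] by simp
  qed
  then show "\<alpha> \<in> tree_auts \<and> level_perm \<alpha> \<in> Q \<and> (\<forall>x. tree_state \<alpha> x \<in> Gamma b G (seq_shift ` \<Omega>))"
    if "\<alpha> \<in> Gamma b G \<Omega>"
    using that by blast
next
  assume *: "\<alpha> \<in> tree_auts \<and> level_perm \<alpha> \<in> Q \<and> (\<forall>x. tree_state \<alpha> x \<in> Gamma b G (seq_shift ` \<Omega>))"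
  from conjunct1[OF conjunct2[OF *]] obtain g where g: "level_perm \<alpha> = level_perm g" "g \<in> G"
    by (rule imageE)
  let ?h = "\<lambda>x. inverse_map (tree_state g x) \<circ> tree_state \<alpha> x"
  have "tree_node id ?h \<in> Gamma b G \<Omega>"
  proof (rule tree_node_id_mem[OF Gamma_subgroup])
    fix x
    have "?h x \<in> Gamma b G (seq_shift ` \<Omega>)"
      using Gamma_comp[OF Gamma_inverse[OF Gamma_incl[OF G_state[OF g(2)]]]] * by blast
    then show "at_letter x (?h x) \<in> Gamma b G \<Omega>"
      by (rule at_letter_Gamma[OF \<Omega>])
  qed
  moreover have "g \<circ> tree_node id ?h = \<alpha>"
  proof -
    have "g \<circ> tree_node id ?h = tree_node (level_perm g) (tree_state g) \<circ> tree_node id ?h"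
      by (simp add: tree_node_eq[OF G_aut[OF g(2)]])
    also have "\<dots> = tree_node (level_perm \<alpha>) (tree_state \<alpha>)"
      unfolding tree_node_comp
    proof (rule tree_node_cong)
      show "tree_state g (id x) \<circ> ?h x = tree_state \<alpha> x" for x
        using tree_autD(1)[OF G_aut[OF G_state[OF g(2)]]] by (simp add: comp_assoc[symmetric])
    qed (simp add: g(1))
    finally show ?thesis
      using * by (simp add: tree_node_eq)
  qed
  ultimately show "\<alpha> \<in> Gamma b G \<Omega>"
    using Gamma_comp[OF Gamma_incl[OF g(2)], of "tree_node id ?h" \<Omega>] by (simp only:)
qed


section \<open>The closure as an iterated wreath product\<close>

primrec locally_in :: "nat \<Rightarrow> ('a list \<Rightarrow> 'a list) \<Rightarrow> bool" where
  "locally_in 0 \<alpha> \<longleftrightarrow> True"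
| "locally_in (Suc n) \<alpha> \<longleftrightarrow> level_perm \<alpha> \<in> Q \<and> (\<forall>x. locally_in n (tree_state \<alpha> x))"

lemma locally_in_agree:
  assumes "\<alpha> \<in> tree_auts" "\<beta> \<in> tree_auts" "agree n \<alpha> \<beta>" "locally_in n \<alpha>"
  shows "locally_in n \<beta>"
  using assms
proof (induction n arbitrary: \<alpha> \<beta>)
  case (Suc n)
  note a = iffD1[OF agree_Suc_iff[OF Suc.prems(1,2)] Suc.prems(3)]
  have "locally_in n (tree_state \<beta> x)" for x
    using Suc.IH[OF tree_aut_node(2)[OF Suc.prems(1), of x] tree_aut_node(2)[OF Suc.prems(2), of x]] a Suc.prems(4)
    by simp
  then show ?case
    using a Suc.prems(4) by simp
qed simp

lemma Gamma_locally_in: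
  assumes "spines \<Omega>" "\<gamma> \<in> Gamma b G \<Omega>"
  shows "locally_in n \<gamma>"
  using assms
proof (induction n arbitrary: \<Omega> \<gamma>)
  case (Suc n)
  note \<gamma> = iffD1[OF Gamma_iff[OF Suc.prems(1)] Suc.prems(2)]
  have "locally_in n (tree_state \<gamma> x)" for x
    using Suc.IH[OF spines_shift[OF Suc.prems(1)]] \<gamma> by blast
  with \<gamma> show ?case
    by simp
qed simp

text \<open>
  Approximate the states on level \<open>n\<close> by elements of the group for the shifted sequences and reassemble;
  no compatibility between the states is required by the decomposition.
\<close>

lemma Gamma_dense:
  assumes "spines \<Omega>" "\<alpha> \<in> tree_auts" "locally_in n \<alpha>"
  shows "\<exists>\<gamma>\<in>Gamma b G \<Omega>. agree n \<gamma> \<alpha>"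
  using assms
proof (induction n arbitrary: \<Omega> \<alpha>)
  case 0
  then show ?case
    using Gamma_id tree_autD(2)[OF 0(2)] by (intro bexI[of _ id]) (auto simp: agree_def)
next
  case (Suc n)
  have "\<exists>\<gamma>\<in>Gamma b G (seq_shift ` \<Omega>). agree n \<gamma> (tree_state \<alpha> x)" for x
    using Suc.IH[OF spines_shift[OF Suc.prems(1)] tree_aut_node(2)[OF Suc.prems(2)]] Suc.prems(3) by simp
  then obtain h where h: "\<And>x. h x \<in> Gamma b G (seq_shift ` \<Omega>)" "\<And>x. agree n (h x) (tree_state \<alpha> x)"
    by metis
  let ?\<gamma> = "tree_node (level_perm \<alpha>) h"
  have aut: "?\<gamma> \<in> tree_auts"
    using Gamma_aut[OF h(1)] tree_aut_node(1)[OF Suc.prems(2)] by (simp add: tree_node_tree_aut_iff)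
  then have "?\<gamma> \<in> Gamma b G \<Omega>"
    unfolding Gamma_iff[OF Suc.prems(1)] using h(1) Suc.prems(3) by simp
  moreover have "agree (Suc n) ?\<gamma> \<alpha>"
    using h(2) by (simp add: agree_Suc_iff[OF aut Suc.prems(2)])
  ultimately show ?case
    by blast
qed

lemma closure_Gamma_iff:
  assumes "spines \<Omega>"
  shows "\<alpha> \<in> tree_auts \<and> (\<forall>n. \<exists>\<gamma>\<in>Gamma b G \<Omega>. agree n \<gamma> \<alpha>) \<longleftrightarrow> \<alpha> \<in> tree_auts \<and> (\<forall>n. locally_in n \<alpha>)"
  using Gamma_dense[OF assms] locally_in_agree[OF Gamma_aut _ _ Gamma_locally_in[OF assms]] by blast

primrec wreath_aut :: "'a wreath \<Rightarrow> 'a list \<Rightarrow> 'a list" where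
  "wreath_aut Unit = id"
| "wreath_aut (Wr q h) = tree_node q (\<lambda>x. wreath_aut (h x))"

lemma wreath_aut:
  assumes "t \<in> wreath_carrier Q n"
  shows "wreath_aut t \<in> tree_auts" "locally_in n (wreath_aut t)"
    and "length w = n \<Longrightarrow> wreath_act t w = wreath_aut t w"
    and "length w \<le> m \<Longrightarrow> wreath_aut (wreath_trunc m t) w = wreath_aut t w"
proof -
  show "wreath_aut t \<in> tree_auts"
    using assms by (induction n arbitrary: t) (auto simp: tree_node_tree_aut_iff Q_bij)
  show "locally_in n (wreath_aut t)"
    using assms by (induction n arbitrary: t) auto
  show "wreath_act t w = wreath_aut t w" if "length w = n"
    using assms that
  proof (induction n arbitrary: t w)
    case (Suc n)
    then show ?case
      by (cases w) auto
  qed simp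
  show "wreath_aut (wreath_trunc m t) w = wreath_aut t w" if "length w \<le> m"
    using assms that
  proof (induction w arbitrary: n m t)
    case Nil
    then show ?case
      by (cases n; cases m) auto
  next
    case (Cons x w)
    from Cons.prems show ?case
      by (cases n; cases m) (auto, meson Cons.IH)
  qed
qed

text \<open>
  The action of \<open>\<alpha>\<close> on the levels up to \<open>n\<close>, encoded as an element of the \<open>n\<close>-fold wreath product.
\<close>

primrec portrait :: "nat \<Rightarrow> ('a list \<Rightarrow> 'a list) \<Rightarrow> 'a wreath" where
  "portrait 0 \<alpha> = Unit"
| "portrait (Suc n) \<alpha> = Wr (level_perm \<alpha>) (\<lambda>x. portrait n (tree_state \<alpha> x))"

lemma portrait_carrier: "locally_in n \<alpha> \<Longrightarrow> portrait n \<alpha> \<in> wreath_carrier Q n"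
  by (induction n arbitrary: \<alpha>) auto

lemma portrait_trunc: "m \<le> n \<Longrightarrow> wreath_trunc m (portrait n \<alpha>) = portrait m \<alpha>"
proof (induction m arbitrary: n \<alpha>)
  case 0
  then show ?case
    by (cases "portrait n \<alpha>") auto
next
  case (Suc m)
  then show ?case
    by (cases n) auto
qed

lemma portrait_act:
  "\<alpha> \<in> tree_auts \<Longrightarrow> wreath_act (portrait (length w) \<alpha>) w = \<alpha> w"
proof (induction w arbitrary: \<alpha>)
  case Nil
  then show ?case
    by (simp add: tree_autD(2))
next
  case (Cons x w)
  then show ?case
    using tree_aut_Cons[OF Cons.prems] tree_aut_node(2)[OF Cons.prems] by simp
qed

lemma wreath_limit_carrier:
  "t \<in> carrier (wreath_limit Q) \<longleftrightarrow>
     (\<forall>n. t n \<in> wreath_carrier Q n) \<and> (\<forall>m n. m \<le> n \<longrightarrow> wreath_trunc m (t n) = t m)"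
  by (auto simp: wreath_limit_def inverse_limit_def wreath_power_def PiE_iff)

lemma wreath_infinity_iff:
  "\<alpha> \<in> wreath_infinity Q \<longleftrightarrow> \<alpha> \<in> tree_auts \<and> (\<forall>n. locally_in n \<alpha>)"
proof
  assume "\<alpha> \<in> wreath_infinity Q"
  then obtain t where \<alpha>: "\<alpha> = wreath_limit_act t" and "t \<in> carrier (wreath_limit Q)"
    unfolding wreath_infinity_def by (rule imageE)
  then have t: "\<And>n. t n \<in> wreath_carrier Q n" "\<And>m n. m \<le> n \<Longrightarrow> wreath_trunc m (t n) = t m"
    unfolding wreath_limit_carrier by blast+
  have eq: "\<alpha> w = wreath_aut (t n) w" if "length w \<le> n" for w n
  proof -
    have "\<alpha> w = wreath_aut (t (length w)) w"
      unfolding \<alpha> wreath_limit_act_def by (rule wreath_aut(3)[OF t(1) refl])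
    also have "\<dots> = wreath_aut (t n) w"
      using wreath_aut(4)[OF t(1)[of n], of w "length w"] t(2)[OF that] by simp
    finally show ?thesis .
  qed
  have aut: "\<alpha> \<in> tree_auts"
    by (rule tree_aut_levelwiseI) (use eq wreath_aut(1)[OF t(1)] in blast)
  moreover have "locally_in n \<alpha>" for n
    by (rule locally_in_agree[OF wreath_aut(1)[OF t(1)] aut _ wreath_aut(2)[OF t(1)]])
      (use eq[of _ n] in \<open>simp add: agree_def\<close>)
  ultimately show "\<alpha> \<in> tree_auts \<and> (\<forall>n. locally_in n \<alpha>)"
    by blast
next
  assume \<alpha>: "\<alpha> \<in> tree_auts \<and> (\<forall>n. locally_in n \<alpha>)"
  let ?t = "\<lambda>n. portrait n \<alpha>"
  have "?t \<in> carrier (wreath_limit Q)"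
    using \<alpha> by (simp add: wreath_limit_carrier portrait_carrier portrait_trunc)
  moreover have "\<alpha> = wreath_limit_act ?t"
    using \<alpha> by (simp add: fun_eq_iff wreath_limit_act_def portrait_act)
  ultimately show "\<alpha> \<in> wreath_infinity Q"
    unfolding wreath_infinity_def by blast
qed

text \<open>
  Level transitivity, in a form that needs no correction by a state: the element carrying \<open>v\<close> to \<open>u\<close>
  can be chosen with trivial state at \<open>v\<close>, because the decomposition allows all states on the way
  to be chosen freely.
\<close>

lemma at_vertex_conjugate:
  assumes "spines \<Omega>" "length u = length v"
  shows "\<exists>\<gamma>\<in>Gamma b G \<Omega>. \<forall>\<beta>. \<gamma> \<circ> at_vertex v \<beta> = at_vertex u \<beta> \<circ> \<gamma>"
  using assms
proof (induction v arbitrary: u \<Omega>)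
  case Nil
  then show ?case
    by (intro bexI[of _ id] Gamma_id) simp
next
  case (Cons x v)
  obtain y u' where u: "u = y # u'" "length u' = length v"
    using Cons.prems(2) by (cases u) auto
  obtain \<gamma> where \<gamma>: "\<gamma> \<in> Gamma b G (seq_shift ` \<Omega>)" "\<And>\<beta>. \<gamma> \<circ> at_vertex v \<beta> = at_vertex u' \<beta> \<circ> \<gamma>"
    using Cons.IH[OF spines_shift[OF Cons.prems(1)] u(2)] by blast
  obtain q where q: "q \<in> Q" "q x = y"
    using property_H_G unfolding property_H_def by blast
  let ?\<delta> = "tree_node q (\<lambda>_. \<gamma>)"
  have "?\<delta> \<in> tree_auts"
    using Gamma_aut[OF \<gamma>(1)] Q_bij[OF q(1)] by (simp add: tree_node_tree_aut_iff)
  then have "?\<delta> \<in> Gamma b G \<Omega>"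
    unfolding Gamma_iff[OF Cons.prems(1)] using \<gamma>(1) q(1) by simp
  moreover have "?\<delta> \<circ> at_vertex (x # v) \<beta> = at_vertex u \<beta> \<circ> ?\<delta>" for \<beta>
  proof -
    have "q z = y \<longleftrightarrow> z = x" for z
      using Q_bij[OF q(1)] q(2) by (auto simp: bij_def dest: injD)
    then show ?thesis
      unfolding u(1) at_vertex.simps at_letter_def tree_node_comp
      by (intro tree_node_cong) (simp_all add: \<gamma>(2))
  qed
  ultimately show ?case
    by blast
qed


section \<open>Normal subgroups\<close>

abbreviation shifts :: "nat \<Rightarrow> (nat \<Rightarrow> 'a) set \<Rightarrow> (nat \<Rightarrow> 'a) set" where
  "shifts n \<Omega> \<equiv> (image seq_shift ^^ n) \<Omega>"

lemma at_vertex_Gamma: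
  assumes "spines \<Omega>" "\<beta> \<in> Gamma b G (shifts (length v) \<Omega>)"
  shows "at_vertex v \<beta> \<in> Gamma b G \<Omega>"
  using assms
proof (induction v arbitrary: \<Omega>)
  case (Cons x v)
  have "at_vertex v \<beta> \<in> Gamma b G (seq_shift ` \<Omega>)"
    using Cons.IH[OF spines_shift[OF Cons.prems(1)]] Cons.prems(2) by (simp add: funpow_swap1)
  then show ?case
    using at_letter_Gamma[OF Cons.prems(1)] by simp
qed simp

text \<open>
  An element that fixes level \<open>n + 1\<close> is the product of its states placed below the letters, and the
  states fix level \<open>n\<close>. The induction therefore passes from \<open>H\<close> to the preimages of \<open>H\<close> under
  \<open>at_letter x\<close> and from \<open>\<Omega>\<close> to its shift.
\<close>

lemma level_stab_generated:
  assumes "spines \<Omega>" "subgroup H tree_Aut"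
    and "\<And>v \<beta>. length v = n \<Longrightarrow> \<beta> \<in> Gamma b G (shifts n \<Omega>) \<Longrightarrow> at_vertex v \<beta> \<in> H"
    and "\<gamma> \<in> Gamma b G \<Omega>" "agree n \<gamma> id"
  shows "\<gamma> \<in> H"
  using assms
proof (induction n arbitrary: \<Omega> H \<gamma>)
  case 0
  then show ?case
    using "0.prems"(3)[of "[]" \<gamma>] by simp
next
  case (Suc n)
  note \<gamma> = iffD1[OF Gamma_iff[OF Suc.prems(1)] Suc.prems(4)]
  then have aut: "\<gamma> \<in> tree_auts"
    by blast
  have trivial: "level_perm \<gamma> = id" "\<And>x. agree n (tree_state \<gamma> x) id"
    using iffD1[OF agree_Suc_iff[OF aut id_tree_aut] Suc.prems(5)] by simp_all
  have "at_letter x (tree_state \<gamma> x) \<in> H" for x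
  proof -
    have "tree_state \<gamma> x \<in> {\<alpha> \<in> tree_auts. at_letter x \<alpha> \<in> H}"
    proof (rule Suc.IH[OF spines_shift[OF Suc.prems(1)]])
      show "subgroup {\<alpha> \<in> tree_auts. at_letter x \<alpha> \<in> H} tree_Aut"
        by (rule subgroup_preimage[OF at_letter_hom Suc.prems(2)])
      show "at_vertex v \<beta> \<in> {\<alpha> \<in> tree_auts. at_letter x \<alpha> \<in> H}"
        if "length v = n" "\<beta> \<in> Gamma b G (shifts n (seq_shift ` \<Omega>))" for v \<beta>
        using Suc.prems(3)[of "x # v" \<beta>] that at_vertex_tree_aut[OF Gamma_aut[OF that(2)]]
        by (simp add: funpow_swap1)
    qed (use \<gamma> trivial(2) in blast)+
    then show ?thesis
      by blast
  qed
  then have "tree_node id (tree_state \<gamma>) \<in> H"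
    by (rule tree_node_id_mem[OF Suc.prems(2)])
  then show ?case
    using tree_node_eq[OF aut] trivial(1) by simp
qed

text \<open>
  The level that is contained is the one of a vertex moved by some \<open>\<nu> \<in> N\<close>: double commutators of \<open>\<nu>\<close>
  with elements supported below \<open>v\<close> stay in \<open>N\<close> and cover the commutators of the copy of the perfect
  group below \<open>v\<close>.
\<close>

lemma normal_subgroup_contains_level_stab:
  assumes \<Omega>: "spines \<Omega>" and N: "subgroup N tree_Aut"
    and normal: "\<And>\<gamma> \<nu>. \<gamma> \<in> Gamma b G \<Omega> \<Longrightarrow> \<nu> \<in> N \<Longrightarrow> \<gamma> \<circ> \<nu> \<circ> inverse_map \<gamma> \<in> N"
    and \<nu>: "\<nu> \<in> N" "\<nu> v \<noteq> v"
    and \<gamma>: "\<gamma> \<in> Gamma b G \<Omega>" "agree (length v) \<gamma> id"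
  shows "\<gamma> \<in> N"
proof (rule level_stab_generated[OF \<Omega> N _ \<gamma>])
  let ?\<Gamma>' = "Gamma b G (shifts (length v) \<Omega>)"
  note N' = subgroup_tree_AutD[OF N]
  have "?\<Gamma>' \<subseteq> {\<alpha> \<in> tree_auts. at_vertex v \<alpha> \<in> N}"
  proof (rule Gamma_perfect)
    show "subgroup {\<alpha> \<in> tree_auts. at_vertex v \<alpha> \<in> N} tree_Aut"
      by (rule subgroup_preimage[OF at_vertex_hom N])
    fix f h assume f: "f \<in> ?\<Gamma>'" and h: "h \<in> ?\<Gamma>'"
    \<comment> \<open>the double commutator of \<open>\<nu>\<close>, \<open>c\<close> and \<open>d\<close> is that of \<open>c\<inverse>\<close> and \<open>d\<close>, so \<open>c\<close> belongs to \<open>f\<inverse>\<close>\<close>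
    let ?f' = "inverse_map f"
    have f': "?f' \<in> ?\<Gamma>'"
      by (rule Gamma_inverse[OF f])
    define a c d where "a = \<nu> \<circ> at_vertex v ?f' \<circ> inverse_map \<nu>" and "c = at_vertex v ?f'" and "d = at_vertex v h"
    have c: "c \<in> Gamma b G \<Omega>" and d: "d \<in> Gamma b G \<Omega>"
      unfolding c_def d_def by (rule at_vertex_Gamma[OF \<Omega>], fact)+
    have bij: "bij \<nu>" "bij c" "bij d"
      using N'(6)[OF \<nu>(1)] tree_autD(1)[OF Gamma_aut[OF c]] tree_autD(1)[OF Gamma_aut[OF d]] by auto
    then have bija: "bij a"
      unfolding a_def c_def[symmetric] by (intro bij_comp bij_imp_bij_inv)
    have ac: "a \<circ> c = c \<circ> a" "a \<circ> d = d \<circ> a"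
      unfolding a_def c_def d_def
      by (intro conj_at_vertex_commutes N'(5)[OF \<nu>(1)] \<nu>(2) Gamma_aut[OF f'] Gamma_aut[OF h])+
    have inv_c: "inverse_map c = at_vertex v f"
    proof -
      have "inverse_map c \<circ> c = at_vertex v f \<circ> c"
        using bij(2) tree_autD(1)[OF Gamma_aut[OF f]]
        by (simp add: c_def at_vertex_comp[symmetric] at_vertex_id)
      then show ?thesis
        using bij(2) by (metis comp_assoc comp_id inverse_map_comp(2))
    qed
    have m: "a \<circ> inverse_map c \<in> N"
    proof -
      have "a \<circ> inverse_map c = \<nu> \<circ> (c \<circ> inverse_map \<nu> \<circ> inverse_map c)"
        by (simp add: a_def c_def comp_assoc)
      then show ?thesis
        using N'(3)[OF \<nu>(1) normal[OF c N'(4)[OF \<nu>(1)]]] by simp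
    qed
    have "commutator (a \<circ> inverse_map c) d = (a \<circ> inverse_map c) \<circ> (d \<circ> inverse_map (a \<circ> inverse_map c) \<circ> inverse_map d)"
      by (simp add: commutator_def comp_assoc)
    then have "commutator (a \<circ> inverse_map c) d \<in> N"
      using N'(3)[OF m normal[OF d N'(4)[OF m]]] by simp
    moreover have "commutator (a \<circ> inverse_map c) d = commutator (inverse_map c) d"
    proof -
      have inv_ac: "inverse_map (a \<circ> inverse_map c) = c \<circ> inverse_map a"
      proof (rule inverse_map_unique[symmetric])
        show "c \<circ> inverse_map a \<circ> (a \<circ> inverse_map c) = id"
          using bij(2) bija by (simp add: fun_eq_iff)
        show "bij (a \<circ> inverse_map c)"
          using bij(2) bija by (intro bij_comp bij_imp_bij_inv)
      qed
      have ac': "a \<circ> inverse_map c = inverse_map c \<circ> a"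
        using ac(1) bij(2) by (metis comp_assoc comp_id id_comp inverse_map_comp)
      have "commutator (a \<circ> inverse_map c) d = inverse_map c \<circ> (a \<circ> d) \<circ> (c \<circ> inverse_map a) \<circ> inverse_map d"
        unfolding commutator_def inv_ac unfolding ac' by (simp add: comp_assoc)
      also have "\<dots> = inverse_map c \<circ> d \<circ> (a \<circ> c) \<circ> inverse_map a \<circ> inverse_map d"
        unfolding ac(2) by (simp add: comp_assoc)
      also have "\<dots> = inverse_map c \<circ> d \<circ> c \<circ> (a \<circ> inverse_map a) \<circ> inverse_map d"
        unfolding ac(1) by (simp add: comp_assoc)
      also have "\<dots> = commutator (inverse_map c) d"
        using bija bij(2) by (simp add: commutator_def inv_inv_eq)
      finally show ?thesis .
    qed
    ultimately have "commutator (at_vertex v f) (at_vertex v h) \<in> N"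
      by (simp add: inv_c d_def)
    moreover have "at_vertex v (commutator f h) = commutator (at_vertex v f) (at_vertex v h)"
      by (rule hom_commutator[of "at_vertex v", OF at_vertex_hom Gamma_aut[OF f] Gamma_aut[OF h]])
    moreover have "commutator f h \<in> tree_auts"
      using commutator_mem[OF Gamma_subgroup f h] by (rule Gamma_aut)
    ultimately show "commutator f h \<in> {\<alpha> \<in> tree_auts. at_vertex v \<alpha> \<in> N}"
      by simp
  qed
  then have v: "at_vertex v \<beta> \<in> N" if "\<beta> \<in> ?\<Gamma>'" for \<beta>
    using that by blast
  fix u :: "'a list" and \<beta> assume u: "length u = length v" and \<beta>: "\<beta> \<in> ?\<Gamma>'"
  obtain \<delta> where \<delta>: "\<delta> \<in> Gamma b G \<Omega>" "\<And>\<beta>. \<delta> \<circ> at_vertex v \<beta> = at_vertex u \<beta> \<circ> \<delta>"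
    using at_vertex_conjugate[OF \<Omega> u] by blast
  have "at_vertex u \<beta> = \<delta> \<circ> at_vertex v \<beta> \<circ> inverse_map \<delta>"
    unfolding \<delta>(2) using tree_autD(1)[OF Gamma_aut[OF \<delta>(1)]] by (simp add: comp_assoc)
  then show "at_vertex u \<beta> \<in> N"
    using normal[OF \<delta>(1) v[OF \<beta>]] by simp
qed

end


section \<open>The topology of the automorphism group\<close>

lemma left_coset_level_stab:
  assumes g: "g \<in> tree_auts"
  shows "g <#\<^bsub>tree_Aut\<^esub> level_stab n = {\<alpha> \<in> tree_auts. agree n \<alpha> g}"
proof (intro Set.set_eqI iffI)
  fix \<alpha> assume "\<alpha> \<in> g <#\<^bsub>tree_Aut\<^esub> level_stab n"
  then obtain \<beta> where \<beta>: "\<beta> \<in> tree_auts" "agree n \<beta> id" "\<alpha> = g \<circ> \<beta>"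
    using g by (auto simp: l_coset_def level_stab_iff)
  then show "\<alpha> \<in> {\<alpha> \<in> tree_auts. agree n \<alpha> g}"
    using g by (auto simp: comp_tree_aut agree_def)
next
  fix \<alpha> assume "\<alpha> \<in> {\<alpha> \<in> tree_auts. agree n \<alpha> g}"
  then have \<alpha>: "\<alpha> \<in> tree_auts" "agree n \<alpha> g"
    by auto
  let ?\<beta> = "inverse_map g \<circ> \<alpha>"
  have "?\<beta> \<in> level_stab n"
    using \<alpha> g by (simp add: level_stab_iff comp_tree_aut inverse_tree_aut) (simp add: agree_def tree_autD(1))
  moreover have "\<alpha> = g \<otimes>\<^bsub>tree_Aut\<^esub> ?\<beta>"
    using \<alpha> g by (simp add: comp_tree_aut inverse_tree_aut tree_autD(1) fun_eq_iff)
  ultimately show "\<alpha> \<in> g <#\<^bsub>tree_Aut\<^esub> level_stab n"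
    by (auto simp: l_coset_def)
qed

lemma tree_topology_eq:
  "tree_topology = topology_generated_by {{\<alpha> \<in> tree_auts. agree n \<alpha> g} | g n. g \<in> tree_auts}"
proof -
  have "{g <#\<^bsub>tree_Aut\<^esub> level_stab l | g l. g \<in> tree_auts} =
      {{\<alpha> \<in> tree_auts. agree n \<alpha> g} | g n. g \<in> (tree_auts :: ('a list \<Rightarrow> 'a list) set)}"
    by (simp add: left_coset_level_stab cong: rev_conj_cong)
  then show ?thesis
    by (simp add: tree_topology_def)
qed

lemma topspace_tree_topology [simp]: "topspace tree_topology = tree_auts"
  unfolding tree_topology_eq topology_generated_by_topspace using agree_refl by blast

text \<open>
  Deeper levels determine shallower ones, so that the sets of automorphisms agreeing with a given
  one on a level form a neighbourhood base and not just a subbase.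
\<close>

lemma openin_tree_topology_iff:
  "openin tree_topology U \<longleftrightarrow>
     U \<subseteq> tree_auts \<and> (\<forall>\<alpha>\<in>U. \<exists>n. \<forall>\<beta>\<in>tree_auts. agree n \<beta> \<alpha> \<longrightarrow> \<beta> \<in> U)"
  (is "_ \<longleftrightarrow> ?nbhd U")
proof
  define S :: "('a list \<Rightarrow> 'a list) set set"
    where "S = {{\<alpha> \<in> tree_auts. agree n \<alpha> g} | g n. g \<in> tree_auts}"
  assume "openin tree_topology U"
  then have "generate_topology_on S U"
    by (simp add: S_def tree_topology_eq openin_topology_generated_by_iff)
  then show "?nbhd U"
  proof (induction rule: generate_topology_on.induct)
    case (Int A B)
    have "\<exists>n. \<forall>\<beta>\<in>tree_auts. agree n \<beta> \<alpha> \<longrightarrow> \<beta> \<in> A \<inter> B" if "\<alpha> \<in> A \<inter> B" for \<alpha>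
    proof -
      from bspec[OF conjunct2[OF Int.IH(1)] IntD1[OF that]]
      obtain m where m: "\<forall>\<beta>\<in>tree_auts. agree m \<beta> \<alpha> \<longrightarrow> \<beta> \<in> A" ..
      from bspec[OF conjunct2[OF Int.IH(2)] IntD2[OF that]]
      obtain n where n: "\<forall>\<beta>\<in>tree_auts. agree n \<beta> \<alpha> \<longrightarrow> \<beta> \<in> B" ..
      have "\<alpha> \<in> tree_auts"
        using that Int.IH(1) by blast
      then have "\<beta> \<in> A \<inter> B" if "\<beta> \<in> tree_auts" "agree (max m n) \<beta> \<alpha>" for \<beta>
        using m n that agree_mono[of \<beta> \<alpha> "max m n" m] agree_mono[of \<beta> \<alpha> "max m n" n] by simp
      then show ?thesis
        by blast
    qed
    moreover have "A \<inter> B \<subseteq> tree_auts"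
      using Int.IH(1) by blast
    ultimately show ?case
      by blast
  next
    case (UN K)
    have "\<exists>n. \<forall>\<beta>\<in>tree_auts. agree n \<beta> \<alpha> \<longrightarrow> \<beta> \<in> \<Union>K" if "\<alpha> \<in> k" "k \<in> K" for \<alpha> k
        using bspec[OF conjunct2[OF UN(2)[OF that(2)]] that(1)] that(2) by (meson UnionI)
    moreover have "\<Union>K \<subseteq> tree_auts"
      using UN(2) by fast
    ultimately show ?case
      by blast
  next
    case (Basis s)
    then obtain g n where "g \<in> tree_auts" "s = {\<alpha> \<in> tree_auts. agree n \<alpha> g}"
      by (auto simp: S_def)
    moreover have "\<forall>\<alpha>\<in>s. \<forall>\<beta>\<in>tree_auts. agree n \<beta> \<alpha> \<longrightarrow> \<beta> \<in> s"
      using calculation by (auto intro: agree_trans)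
    ultimately show ?case
      by blast
  qed simp
next
  assume U: "?nbhd U"
  have "\<exists>V. openin tree_topology V \<and> \<alpha> \<in> V \<and> V \<subseteq> U" if "\<alpha> \<in> U" for \<alpha>
  proof -
    from bspec[OF conjunct2[OF U] that]
    obtain n where n: "\<forall>\<beta>\<in>tree_auts. agree n \<beta> \<alpha> \<longrightarrow> \<beta> \<in> U" ..
    have "\<alpha> \<in> tree_auts"
      using U that by blast
    then have "openin tree_topology {\<beta> \<in> tree_auts. agree n \<beta> \<alpha>}"
      unfolding tree_topology_eq by (intro topology_generated_by_Basis) blast
    with n \<open>\<alpha> \<in> tree_auts\<close> show ?thesis
      by (intro exI[of _ "{\<beta> \<in> tree_auts. agree n \<beta> \<alpha>}"]) auto
  qed
  then show "openin tree_topology U"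
    using openin_subopen by blast
qed

lemma openin_subtopology_tree_iff:
  assumes C: "C \<subseteq> tree_auts"
  shows "openin (subtopology tree_topology C) W \<longleftrightarrow>
     W \<subseteq> C \<and> (\<forall>\<alpha>\<in>W. \<exists>n. \<forall>\<beta>\<in>C. agree n \<beta> \<alpha> \<longrightarrow> \<beta> \<in> W)"
proof
  assume "openin (subtopology tree_topology C) W"
  then obtain U where U: "openin tree_topology U" "W = U \<inter> C"
    by (auto simp: openin_subtopology)
  have "\<exists>n. \<forall>\<beta>\<in>C. agree n \<beta> \<alpha> \<longrightarrow> \<beta> \<in> W" if "\<alpha> \<in> W" for \<alpha>
  proof -
    have "\<alpha> \<in> U"
      using that U(2) by simp
    from bspec[OF conjunct2[OF U(1)[unfolded openin_tree_topology_iff]] this]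
    obtain n where "\<forall>\<beta>\<in>tree_auts. agree n \<beta> \<alpha> \<longrightarrow> \<beta> \<in> U" ..
    then have "\<forall>\<beta>\<in>C. agree n \<beta> \<alpha> \<longrightarrow> \<beta> \<in> W"
      using U(2) C by blast
    then show ?thesis ..
  qed
  with U(2) show "W \<subseteq> C \<and> (\<forall>\<alpha>\<in>W. \<exists>n. \<forall>\<beta>\<in>C. agree n \<beta> \<alpha> \<longrightarrow> \<beta> \<in> W)"
    by blast
next
  assume W: "W \<subseteq> C \<and> (\<forall>\<alpha>\<in>W. \<exists>n. \<forall>\<beta>\<in>C. agree n \<beta> \<alpha> \<longrightarrow> \<beta> \<in> W)"
  define U where "U = {\<beta> \<in> tree_auts. \<exists>n. \<forall>\<gamma>\<in>C. agree n \<gamma> \<beta> \<longrightarrow> \<gamma> \<in> W}"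
  have "openin tree_topology U"
    unfolding openin_tree_topology_iff
  proof (intro conjI ballI)
    fix \<alpha> assume "\<alpha> \<in> U"
    then obtain n where "\<forall>\<gamma>\<in>C. agree n \<gamma> \<alpha> \<longrightarrow> \<gamma> \<in> W"
      by (auto simp: U_def)
    then have "\<forall>\<beta>\<in>tree_auts. agree n \<beta> \<alpha> \<longrightarrow> \<beta> \<in> U"
      using agree_trans by (fastforce simp: U_def)
    then show "\<exists>n. \<forall>\<beta>\<in>tree_auts. agree n \<beta> \<alpha> \<longrightarrow> \<beta> \<in> U" ..
  qed (auto simp: U_def)
  moreover have "W = U \<inter> C"
    using W C agree_refl by (fastforce simp: U_def)
  ultimately show "openin (subtopology tree_topology C) W"
    by (auto simp: openin_subtopology)
qed

lemma closure_of_tree_topology: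
  assumes \<Gamma>: "\<Gamma> \<subseteq> tree_auts"
  shows "tree_topology closure_of \<Gamma> = {\<alpha> \<in> tree_auts. \<forall>n. \<exists>\<gamma>\<in>\<Gamma>. agree n \<gamma> \<alpha>}"
proof (intro Set.set_eqI iffI)
  fix \<alpha> assume \<alpha>: "\<alpha> \<in> tree_topology closure_of \<Gamma>"
  have "\<exists>\<gamma>\<in>\<Gamma>. agree n \<gamma> \<alpha>" for n
  proof -
    have "openin tree_topology {\<beta> \<in> tree_auts. agree n \<beta> \<alpha>}"
      unfolding openin_tree_topology_iff by (auto intro: agree_trans)
    moreover have "\<alpha> \<in> tree_auts" "\<forall>T. \<alpha> \<in> T \<and> openin tree_topology T \<longrightarrow> (\<exists>y. y \<in> \<Gamma> \<and> y \<in> T)"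
      using \<alpha> by (simp_all add: in_closure_of)
    ultimately show ?thesis
      by (metis (mono_tags, lifting) agree_refl mem_Collect_eq)
  qed
  then show "\<alpha> \<in> {\<alpha> \<in> tree_auts. \<forall>n. \<exists>\<gamma>\<in>\<Gamma>. agree n \<gamma> \<alpha>}"
    using \<alpha> by (auto simp: in_closure_of)
next
  fix \<alpha> assume "\<alpha> \<in> {\<alpha> \<in> tree_auts. \<forall>n. \<exists>\<gamma>\<in>\<Gamma>. agree n \<gamma> \<alpha>}"
  then show "\<alpha> \<in> tree_topology closure_of \<Gamma>"
    using \<Gamma> unfolding in_closure_of openin_tree_topology_iff topspace_tree_topology by blast
qed


section \<open>Level stabilizers as subgroups of finite index\<close>

locale tree_subgroup =
  fixes \<Gamma> :: "('a::finite list \<Rightarrow> 'a list) set"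
  assumes subgroup: "subgroup \<Gamma> tree_Aut"
begin

lemmas
  subset = subgroup_tree_AutD(1)[OF subgroup] and
  id_mem = subgroup_tree_AutD(2)[OF subgroup] and
  comp_mem = subgroup_tree_AutD(3)[OF subgroup] and
  inverse_mem = subgroup_tree_AutD(4)[OF subgroup] and
  tree_aut = subgroup_tree_AutD(5)[OF subgroup] and
  bij = subgroup_tree_AutD(6)[OF subgroup]

abbreviation A where "A \<equiv> aut_group \<Gamma>"

sublocale A: group A
  by (rule group.subgroup_imp_group[OF group_tree_Aut subgroup])

lemma inv_eq [simp]: "\<alpha> \<in> \<Gamma> \<Longrightarrow> inv\<^bsub>A\<^esub> \<alpha> = inverse_map \<alpha>"
  using group.m_inv_consistent[OF group_tree_Aut subgroup] by (simp add: tree_aut)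

lemma subgroup_iff:
  "Group.subgroup N A \<longleftrightarrow> N \<subseteq> \<Gamma> \<and> Group.subgroup N tree_Aut"
  using group.incl_subgroup[OF group_tree_Aut subgroup] group.subgroup_incl[OF group_tree_Aut _ subgroup]
    subgroup.subset[of N A] by auto

lemma normal_iff:
  "N \<lhd> A \<longleftrightarrow> N \<subseteq> \<Gamma> \<and> Group.subgroup N tree_Aut \<and> (\<forall>\<gamma>\<in>\<Gamma>. \<forall>\<nu>\<in>N. \<gamma> \<circ> \<nu> \<circ> inverse_map \<gamma> \<in> N)"
proof -
  have "\<gamma> \<otimes>\<^bsub>A\<^esub> \<nu> \<otimes>\<^bsub>A\<^esub> inv\<^bsub>A\<^esub> \<gamma> = \<gamma> \<circ> \<nu> \<circ> inverse_map \<gamma>" if "\<gamma> \<in> \<Gamma>" "\<nu> \<in> N" "N \<subseteq> \<Gamma>" for \<gamma> \<nu>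
    using that comp_mem[of \<gamma> \<nu>] inverse_mem[of \<gamma>] by (simp add: subset_iff tree_aut)
  then show ?thesis
    unfolding A.normal_inv_iff subgroup_iff by (auto simp: subset_iff)
qed

definition stab :: "nat \<Rightarrow> ('a list \<Rightarrow> 'a list) set" where
  "stab n = \<Gamma> \<inter> level_stab n"

lemma stab_iff: "\<gamma> \<in> stab n \<longleftrightarrow> \<gamma> \<in> \<Gamma> \<and> agree n \<gamma> id"
  using tree_aut by (auto simp: stab_def level_stab_iff)

lemma stab_mono: "m \<le> n \<Longrightarrow> stab n \<subseteq> stab m"
  using agree_mono[OF tree_aut id_tree_aut] by (auto simp: stab_iff)

lemma stab_normal: "stab n \<lhd> A"
  unfolding normal_iff
proof (intro conjI ballI)
  show "Group.subgroup (stab n) tree_Aut"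
    unfolding subgroup_tree_Aut_iff
  proof (intro conjI ballI)
    show "stab n \<subseteq> tree_auts"
      using tree_aut by (auto simp: stab_iff)
    show "id \<in> stab n"
      by (simp add: stab_iff id_mem)
    show "\<alpha> \<circ> \<beta> \<in> stab n" if "\<alpha> \<in> stab n" "\<beta> \<in> stab n" for \<alpha> \<beta>
      using that comp_mem by (simp add: stab_iff agree_def)
    show "inverse_map \<alpha> \<in> stab n" if "\<alpha> \<in> stab n" for \<alpha>
      using that inverse_mem inverse_map_apply(1)[OF bij[of \<alpha>]]
      by (simp add: stab_iff agree_def) metis
  qed
next
  fix \<gamma> \<nu> assume \<gamma>: "\<gamma> \<in> \<Gamma>" and \<nu>: "\<nu> \<in> stab n"
  have "length (inverse_map \<gamma> w) = length w" for w
    by (rule tree_aut_length(1)[OF inverse_tree_aut[OF tree_aut[OF \<gamma>]]])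
  then show "\<gamma> \<circ> \<nu> \<circ> inverse_map \<gamma> \<in> stab n"
    using \<gamma> \<nu> comp_mem inverse_mem bij by (simp add: stab_iff agree_def)
qed (auto simp: stab_iff)

lemma coset_stab:
  assumes "\<gamma> \<in> \<Gamma>"
  shows "stab n #>\<^bsub>A\<^esub> \<gamma> = {\<delta> \<in> \<Gamma>. agree n \<delta> \<gamma>}"
proof (intro Set.set_eqI iffI)
  fix \<delta> assume "\<delta> \<in> stab n #>\<^bsub>A\<^esub> \<gamma>"
  then obtain \<nu> where "\<nu> \<in> stab n" "\<delta> = \<nu> \<circ> \<gamma>"
    using assms by (auto simp: r_coset_def stab_iff tree_aut)
  moreover have "length (\<gamma> w) = length w" for w
    by (rule tree_aut_length(1)[OF tree_aut[OF assms]])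
  ultimately show "\<delta> \<in> {\<delta> \<in> \<Gamma>. agree n \<delta> \<gamma>}"
    using assms comp_mem by (auto simp: stab_iff agree_def)
next
  fix \<delta> assume "\<delta> \<in> {\<delta> \<in> \<Gamma>. agree n \<delta> \<gamma>}"
  then have \<delta>: "\<delta> \<in> \<Gamma>" "agree n \<delta> \<gamma>"
    by auto
  have len: "length (inverse_map \<gamma> w) = length w" for w
    by (rule tree_aut_length(1)[OF inverse_tree_aut[OF tree_aut[OF assms]]])
  let ?\<nu> = "\<delta> \<circ> inverse_map \<gamma>"
  have "?\<nu> \<in> stab n"
    using \<delta> assms len bij comp_mem inverse_mem by (simp add: stab_iff agree_def)
  moreover have "\<delta> = ?\<nu> \<otimes>\<^bsub>A\<^esub> \<gamma>"
    using \<delta> assms comp_mem inverse_mem by (simp add: tree_aut bij fun_eq_iff)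
  ultimately show "\<delta> \<in> stab n #>\<^bsub>A\<^esub> \<gamma>"
    by (auto simp: r_coset_def)
qed

text \<open>
  There are finitely many cosets because there are finitely many maps of a level to itself.
\<close>

lemma stab_finite_index: "stab n \<in> finite_index_normal A"
proof -
  define W where "W = {w :: 'a list. length w = n}"
  have fin: "finite W"
    unfolding W_def using finite_lists_length_eq[of "UNIV :: 'a set" n] by simp
  have "rcosets\<^bsub>A\<^esub> (stab n) = (\<lambda>\<gamma>. {\<delta> \<in> \<Gamma>. agree n \<delta> \<gamma>}) ` \<Gamma>"
    using coset_stab[of _ n] by (auto simp: RCOSETS_def)
  also have "\<dots> \<subseteq> (\<lambda>s. {\<delta> \<in> \<Gamma>. \<forall>w\<in>W. \<delta> w = s w}) ` (W \<rightarrow>\<^sub>E W)"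
  proof (intro image_subsetI)
    fix \<gamma> assume "\<gamma> \<in> \<Gamma>"
    have "{\<delta> \<in> \<Gamma>. agree n \<delta> \<gamma>} = {\<delta> \<in> \<Gamma>. \<forall>w\<in>W. \<delta> w = restrict \<gamma> W w}"
      by (auto simp: agree_def W_def)
    moreover have "restrict \<gamma> W \<in> W \<rightarrow>\<^sub>E W"
      using tree_aut_length(1)[OF tree_aut[OF \<open>\<gamma> \<in> \<Gamma>\<close>]] by (auto simp: W_def)
    ultimately show "{\<delta> \<in> \<Gamma>. agree n \<delta> \<gamma>} \<in> (\<lambda>s. {\<delta> \<in> \<Gamma>. \<forall>w\<in>W. \<delta> w = s w}) ` (W \<rightarrow>\<^sub>E W)"
      by (rule image_eqI)
  qed
  finally have "finite (rcosets\<^bsub>A\<^esub> (stab n))"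
    using finite_subset[OF _ finite_imageI[OF finite_PiE[OF fin fin]]] by blast
  with stab_normal show ?thesis
    by (simp add: finite_index_normal_def)
qed

end


section \<open>The profinite completion and the canonical map\<close>

context tree_subgroup
begin

abbreviation completion where "completion \<equiv> carrier (profinite_completion A)"

lemma completion_iff:
  "f \<in> completion \<longleftrightarrow> f \<in> extensional (finite_index_normal A) \<and>
     (\<forall>N\<in>finite_index_normal A. f N \<in> rcosets\<^bsub>A\<^esub> N) \<and>
     (\<forall>N\<in>finite_index_normal A. \<forall>M\<in>finite_index_normal A. M \<subseteq> N \<longrightarrow> N <#>\<^bsub>A\<^esub> f M = f N)"
  unfolding profinite_completion_def inverse_limit_def
  by (auto simp: PiE_iff FactGroup_def)

lemma finite_index_normalD:
  assumes "N \<in> finite_index_normal A"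
  shows "N \<lhd> A" "Group.subgroup N A" "N \<subseteq> \<Gamma>" "id \<in> N"
  using assms normal_imp_subgroup[of N A] subgroup.subset[of N A] subgroup.one_closed[of N A]
  by (auto simp: finite_index_normal_def)

lemma coset_refine:
  assumes "N \<in> finite_index_normal A" "M \<in> finite_index_normal A" "M \<subseteq> N" "\<gamma> \<in> \<Gamma>"
  shows "N <#>\<^bsub>A\<^esub> (M #>\<^bsub>A\<^esub> \<gamma>) = N #>\<^bsub>A\<^esub> \<gamma>"
proof -
  note N = finite_index_normalD[OF assms(1)] and M = finite_index_normalD[OF assms(2)]
  have "N <#>\<^bsub>A\<^esub> M = N"
  proof
    show "N <#>\<^bsub>A\<^esub> M \<subseteq> N"
      using assms(3) subgroup.m_closed[OF N(2)] unfolding set_mult_def by blast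
    show "N \<subseteq> N <#>\<^bsub>A\<^esub> M"
    proof
      fix \<nu> assume \<nu>: "\<nu> \<in> N"
      then have "\<nu> \<otimes>\<^bsub>A\<^esub> id = \<nu>"
        using N(3) id_mem by (auto simp: tree_aut)
      then show "\<nu> \<in> N <#>\<^bsub>A\<^esub> M"
        using M(4) \<nu> unfolding set_mult_def by blast
    qed
  qed
  moreover have "N \<subseteq> carrier A" "M \<subseteq> carrier A" "\<gamma> \<in> carrier A"
    using N(3) M(3) assms(4) by auto
  ultimately show ?thesis
    using A.setmult_rcos_assoc[of N M \<gamma>] by metis
qed

lemma coset_repr:
  assumes f: "f \<in> completion" and N: "N \<in> finite_index_normal A" and \<gamma>: "\<gamma> \<in> f N"
  shows "\<gamma> \<in> \<Gamma>" "f N = N #>\<^bsub>A\<^esub> \<gamma>"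
proof -
  obtain \<delta> where \<delta>: "\<delta> \<in> carrier A" "f N = N #>\<^bsub>A\<^esub> \<delta>"
    using f N unfolding completion_iff RCOSETS_def by blast
  have "N #>\<^bsub>A\<^esub> \<delta> \<subseteq> carrier A"
    using A.r_coset_subset_G[OF _ \<delta>(1)] finite_index_normalD(3)[OF N] by simp
  then show "\<gamma> \<in> \<Gamma>"
    using \<gamma> \<delta>(2) by auto
  show "f N = N #>\<^bsub>A\<^esub> \<gamma>"
    using A.repr_independence[of \<gamma> N \<delta>] \<gamma> \<delta> finite_index_normalD(2)[OF N] by metis
qed

lemma coset_repr_exists:
  assumes "f \<in> completion" "N \<in> finite_index_normal A"
  obtains \<gamma> where "\<gamma> \<in> f N" "\<gamma> \<in> \<Gamma>" "f N = N #>\<^bsub>A\<^esub> \<gamma>"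
proof -
  obtain \<delta> where \<delta>: "\<delta> \<in> carrier A" "f N = N #>\<^bsub>A\<^esub> \<delta>"
    using assms unfolding completion_iff RCOSETS_def by blast
  then have "\<delta> \<in> f N"
    using A.rcos_self[OF _ finite_index_normalD(2)[OF assms(2)]] by metis
  then show ?thesis
    using that coset_repr[OF assms] by blast
qed

lemma coset_coarsen:
  assumes "f \<in> completion" "N \<in> finite_index_normal A" "M \<in> finite_index_normal A" "M \<subseteq> N" "\<gamma> \<in> f M"
  shows "f N = N #>\<^bsub>A\<^esub> \<gamma>"
proof -
  have "f N = N <#>\<^bsub>A\<^esub> f M"
    using assms(1-4) unfolding completion_iff by metis
  also have "\<dots> = N #>\<^bsub>A\<^esub> \<gamma>"
    using coset_repr[OF assms(1,3,5)] coset_refine[OF assms(2-4)] by metis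
  finally show ?thesis .
qed

text \<open>
  The image of a coherent family of cosets is read off level by level; the choice of the representative
  does not matter, by \<open>res_value_eq\<close>.
\<close>

definition res_value :: "(('a list \<Rightarrow> 'a list) set \<Rightarrow> ('a list \<Rightarrow> 'a list) set) \<Rightarrow> 'a list \<Rightarrow> 'a list" where
  "res_value f w = (SOME \<gamma>. \<gamma> \<in> f (stab (length w))) w"

lemma res_value_eq:
  assumes f: "f \<in> completion" and \<gamma>: "\<gamma> \<in> f (stab n)" and len: "length w \<le> n"
  shows "res_value f w = \<gamma> w"
proof -
  let ?m = "length w"
  have \<Gamma>: "\<gamma> \<in> \<Gamma>"
    by (rule coset_repr(1)[OF f stab_finite_index \<gamma>])
  have eq: "f (stab ?m) = {\<delta> \<in> \<Gamma>. agree ?m \<delta> \<gamma>}"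
    using coset_coarsen[OF f stab_finite_index stab_finite_index stab_mono[OF len] \<gamma>] coset_stab[OF \<Gamma>]
    by metis
  define \<delta> where "\<delta> = (SOME \<delta>. \<delta> \<in> f (stab ?m))"
  have "\<gamma> \<in> f (stab ?m)"
    unfolding eq using \<Gamma> by simp
  then have "\<delta> \<in> f (stab ?m)"
    unfolding \<delta>_def by (rule someI[of "\<lambda>\<delta>. \<delta> \<in> f (stab ?m)"])
  then have "agree ?m \<delta> \<gamma>"
    using eq by blast
  then have "\<delta> w = \<gamma> w"
    unfolding agree_def by blast
  then show ?thesis
    unfolding res_value_def \<delta>_def .
qed

lemma res_value_agree:
  assumes "f \<in> completion" "\<gamma> \<in> f (stab n)"
  shows "agree n (res_value f) \<gamma>"
  using res_value_eq[OF assms] by (simp add: agree_def)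

lemma completion_stab:
  assumes f: "f \<in> completion"
  shows "f (stab n) = {\<gamma> \<in> \<Gamma>. agree n \<gamma> (res_value f)}"
proof -
  obtain \<delta> where \<delta>: "\<delta> \<in> f (stab n)" "\<delta> \<in> \<Gamma>" "f (stab n) = stab n #>\<^bsub>A\<^esub> \<delta>"
    by (rule coset_repr_exists[OF f stab_finite_index])
  have "f (stab n) = {\<gamma> \<in> \<Gamma>. agree n \<gamma> \<delta>}"
    using \<delta>(3) coset_stab[OF \<delta>(2)] by (rule trans)
  then show ?thesis
    using res_value_agree[OF f \<delta>(1)] agree_sym agree_trans by blast
qed

lemma agree_res_value_iff:
  assumes "f \<in> completion" "f' \<in> completion"
  shows "agree n (res_value f) (res_value f') \<longleftrightarrow> f (stab n) = f' (stab n)"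
proof
  assume "agree n (res_value f) (res_value f')"
  then show "f (stab n) = f' (stab n)"
    unfolding completion_stab[OF assms(1)] completion_stab[OF assms(2)]
    using agree_sym agree_trans by blast
next
  assume eq: "f (stab n) = f' (stab n)"
  obtain \<gamma> where "\<gamma> \<in> f (stab n)"
    using coset_repr_exists[OF assms(1) stab_finite_index] by metis
  then show "agree n (res_value f) (res_value f')"
    using agree_trans[OF res_value_agree[OF assms(1), of \<gamma>] agree_sym[OF res_value_agree[OF assms(2), of \<gamma>]]] eq
    by simp
qed

lemma res_value_closure:
  assumes f: "f \<in> completion"
  shows "res_value f \<in> tree_topology closure_of \<Gamma>"
proof -
  have \<gamma>: "\<exists>\<gamma>. \<gamma> \<in> \<Gamma> \<and> \<gamma> \<in> f (stab n)" for n
    using coset_repr_exists[OF f stab_finite_index] by metis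
  have "res_value f \<in> tree_auts"
  proof (rule tree_aut_levelwiseI)
    show "\<exists>\<beta>\<in>tree_auts. \<forall>w. length w \<le> n \<longrightarrow> res_value f w = \<beta> w" for n
      using \<gamma>[of n] res_value_eq[OF f] tree_aut by blast
  qed
  moreover have "\<exists>\<gamma>\<in>\<Gamma>. agree n \<gamma> (res_value f)" for n
    using \<gamma>[of n] agree_sym[OF res_value_agree[OF f]] by blast
  ultimately show ?thesis
    by (simp add: closure_of_tree_topology[OF subset])
qed

lemma res_value_tree_aut: "f \<in> completion \<Longrightarrow> res_value f \<in> tree_auts"
  using res_value_closure by (simp add: closure_of_tree_topology[OF subset])

text \<open>
  A product of families is computed with representatives. Closure under multiplication is proved here
  along the way, as the inverse limit is only defined as a set with an operation.
\<close>

lemma completion_mult: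
  assumes f: "f \<in> completion" and f': "f' \<in> completion"
  defines "h \<equiv> f \<otimes>\<^bsub>profinite_completion A\<^esub> f'"
  shows "h \<in> completion" "res_value h = res_value f \<circ> res_value f'"
proof -
  have h: "h N = f N <#>\<^bsub>A\<^esub> f' N" if "N \<in> finite_index_normal A" for N
    using that unfolding h_def profinite_completion_def inverse_limit_def
    by (simp add: FactGroup_def)
  have ext: "h \<in> extensional (finite_index_normal A)"
    unfolding h_def profinite_completion_def inverse_limit_def by simp
  have eq: "h N = N #>\<^bsub>A\<^esub> (\<gamma> \<circ> \<gamma>')"
    if N: "N \<in> finite_index_normal A" and \<gamma>: "\<gamma> \<in> f N" "\<gamma>' \<in> f' N" for N \<gamma> \<gamma>'
  proof -
    note r = coset_repr[OF f N \<gamma>(1)] coset_repr[OF f' N \<gamma>(2)]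
    have "h N = (N #>\<^bsub>A\<^esub> \<gamma>) <#>\<^bsub>A\<^esub> (N #>\<^bsub>A\<^esub> \<gamma>')"
      using h[OF N] r by metis
    also have "\<dots> = N #>\<^bsub>A\<^esub> (\<gamma> \<otimes>\<^bsub>A\<^esub> \<gamma>')"
      using r by (intro normal.rcos_sum[OF finite_index_normalD(1)[OF N]]) auto
    also have "\<gamma> \<otimes>\<^bsub>A\<^esub> \<gamma>' = \<gamma> \<circ> \<gamma>'"
      using r by (simp add: tree_aut)
    finally show ?thesis .
  qed
  have coset: "h N \<in> rcosets\<^bsub>A\<^esub> N" if N: "N \<in> finite_index_normal A" for N
    using normal.setmult_closed[OF finite_index_normalD(1)[OF N]] h[OF N] f f' N
    unfolding completion_iff by metis
  have compat: "N <#>\<^bsub>A\<^esub> h M = h N"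
    if N: "N \<in> finite_index_normal A" and M: "M \<in> finite_index_normal A" and "M \<subseteq> N" for N M
  proof -
    obtain \<gamma> where \<gamma>: "\<gamma> \<in> f M" "\<gamma> \<in> \<Gamma>"
      using coset_repr_exists[OF f M] by metis
    obtain \<gamma>' where \<gamma>': "\<gamma>' \<in> f' M" "\<gamma>' \<in> \<Gamma>"
      using coset_repr_exists[OF f' M] by metis
    have self: "\<delta> \<in> N #>\<^bsub>A\<^esub> \<delta>" if "\<delta> \<in> \<Gamma>" for \<delta>
      by (rule A.rcos_self[OF _ finite_index_normalD(2)[OF N]]) (use that in simp)
    have "\<gamma> \<in> f N" "\<gamma>' \<in> f' N"
      using self[OF \<gamma>(2)] self[OF \<gamma>'(2)] coset_coarsen[OF f N M \<open>M \<subseteq> N\<close> \<gamma>(1)]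
        coset_coarsen[OF f' N M \<open>M \<subseteq> N\<close> \<gamma>'(1)] by metis+
    then have "h N = N #>\<^bsub>A\<^esub> (\<gamma> \<circ> \<gamma>')"
      by (rule eq[OF N])
    moreover have "h M = M #>\<^bsub>A\<^esub> (\<gamma> \<circ> \<gamma>')"
      by (rule eq[OF M \<gamma>(1) \<gamma>'(1)])
    ultimately show ?thesis
      using coset_refine[OF N M \<open>M \<subseteq> N\<close> comp_mem[OF \<gamma>(2) \<gamma>'(2)]] by metis
  qed
  show mem: "h \<in> completion"
    unfolding completion_iff using ext coset compat by blast
  show "res_value h = res_value f \<circ> res_value f'"
  proof (rule agree_eqI)
    fix n
    obtain \<gamma> where \<gamma>: "\<gamma> \<in> f (stab n)" "\<gamma> \<in> \<Gamma>"
      using coset_repr_exists[OF f stab_finite_index] by metis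
    obtain \<gamma>' where \<gamma>': "\<gamma>' \<in> f' (stab n)" "\<gamma>' \<in> \<Gamma>"
      using coset_repr_exists[OF f' stab_finite_index] by metis
    have \<Gamma>: "\<gamma> \<circ> \<gamma>' \<in> \<Gamma>"
      by (rule comp_mem[OF \<gamma>(2) \<gamma>'(2)])
    have "h (stab n) = {\<delta> \<in> \<Gamma>. agree n \<delta> (\<gamma> \<circ> \<gamma>')}"
      using eq[OF stab_finite_index \<gamma>(1) \<gamma>'(1)] coset_stab[OF \<Gamma>] by (rule trans)
    then have "\<gamma> \<circ> \<gamma>' \<in> h (stab n)"
      using \<Gamma> by simp
    then have "agree n (res_value h) (\<gamma> \<circ> \<gamma>')"
      by (rule res_value_agree[OF mem])
    moreover have "agree n (res_value f \<circ> res_value f') (\<gamma> \<circ> \<gamma>')"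
      using agree_comp[OF res_value_tree_aut[OF f']] res_value_agree[OF f \<gamma>(1)] res_value_agree[OF f' \<gamma>'(1)] .
    ultimately show "agree n (res_value h) (res_value f \<circ> res_value f')"
      by (rule agree_trans[OF _ agree_sym])
  qed
qed

lemma completion_map_mem:
  assumes \<gamma>: "\<gamma> \<in> \<Gamma>"
  shows "completion_map A \<gamma> \<in> completion" "res_value (completion_map A \<gamma>) = \<gamma>"
proof -
  let ?f = "completion_map A \<gamma>"
  have f: "?f N = N #>\<^bsub>A\<^esub> \<gamma>" if "N \<in> finite_index_normal A" for N
    using that by (simp add: completion_map_def)
  have "N #>\<^bsub>A\<^esub> \<gamma> \<in> rcosets\<^bsub>A\<^esub> N" if "N \<in> finite_index_normal A" for N
    using finite_index_normalD(3)[OF that] \<gamma> by (intro A.rcosetsI) auto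
  then show mem: "?f \<in> completion"
    unfolding completion_iff using f coset_refine \<gamma> by (simp add: completion_map_def)
  have "?f (stab n) = {\<delta> \<in> \<Gamma>. agree n \<delta> \<gamma>}" for n
    using f[OF stab_finite_index] coset_stab[OF \<gamma>] by (rule trans)
  then have "\<gamma> \<in> ?f (stab n)" for n
    using \<gamma> by simp
  then show "res_value ?f = \<gamma>"
    by (intro agree_eqI res_value_agree[OF mem])
qed

lemma topspace_profinite [simp]: "topspace (profinite_topology A) = completion"
  unfolding profinite_topology_def
  by (auto simp: profinite_completion_def inverse_limit_def)

end

text \<open>
  The congruence subgroup property: the topology of \<open>\<Gamma>\<close> as a subgroup of the automorphism group is
  the full profinite topology.
\<close>

locale congruence_tree_subgroup = tree_subgroup +
  assumes congruence: "N \<in> finite_index_normal A \<Longrightarrow> \<exists>n. stab n \<subseteq> N"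
begin

lemma completion_eq_at:
  assumes "f \<in> completion" "f' \<in> completion" "N \<in> finite_index_normal A" "stab n \<subseteq> N"
    "f (stab n) = f' (stab n)"
  shows "f N = f' N"
proof -
  obtain \<gamma> where "\<gamma> \<in> f (stab n)"
    using coset_repr_exists[OF assms(1) stab_finite_index] by metis
  then show ?thesis
    using coset_coarsen[OF assms(1,3) stab_finite_index assms(4)]
      coset_coarsen[OF assms(2,3) stab_finite_index assms(4)] assms(5) by metis
qed

text \<open>
  A basic open set restricts finitely many components. By the congruence property each of them is
  determined by the component at some level stabilizer, and the deepest of these levels determines
  all of them.
\<close>

lemma openin_profinite_iff:
  "openin (profinite_topology A) V \<longleftrightarrow>
     V \<subseteq> completion \<and> (\<forall>f\<in>V. \<exists>n. \<forall>f'\<in>completion. f' (stab n) = f (stab n) \<longrightarrow> f' \<in> V)"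
proof
  let ?P = "product_topology (\<lambda>N. discrete_topology (carrier (A Mod N))) (finite_index_normal A)"
  assume "openin (profinite_topology A) V"
  then obtain U where U: "openin ?P U" "V = U \<inter> completion"
    by (auto simp: profinite_topology_def openin_subtopology)
  have "\<exists>n. \<forall>f'\<in>completion. f' (stab n) = f (stab n) \<longrightarrow> f' \<in> V" if "f \<in> V" for f
  proof -
    have f: "f \<in> U" "f \<in> completion"
      using that U(2) by auto
    from bspec[OF U(1)[unfolded openin_product_topology_alt] f(1)] obtain X where
      "finite {N \<in> finite_index_normal A. X N \<noteq> topspace (discrete_topology (carrier (A Mod N)))} \<and>
       (\<forall>N\<in>finite_index_normal A. openin (discrete_topology (carrier (A Mod N))) (X N)) \<and>
       f \<in> Pi\<^sub>E (finite_index_normal A) X \<and> Pi\<^sub>E (finite_index_normal A) X \<subseteq> U" ..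
    then have X:
      "finite {N \<in> finite_index_normal A. X N \<noteq> topspace (discrete_topology (carrier (A Mod N)))}"
      "f \<in> Pi\<^sub>E (finite_index_normal A) X" "Pi\<^sub>E (finite_index_normal A) X \<subseteq> U"
      by auto
    define F where "F = {N \<in> finite_index_normal A. X N \<noteq> carrier (A Mod N)}"
    have fin: "finite F"
      using X(1) by (simp add: F_def)
    obtain m where m: "\<And>N. N \<in> F \<Longrightarrow> stab (m N) \<subseteq> N"
      using congruence unfolding F_def by (metis (no_types, lifting) mem_Collect_eq)
    define n where "n = Max (insert 0 (m ` F))"
    have "f' \<in> V" if f': "f' \<in> completion" "f' (stab n) = f (stab n)" for f'
    proof -
      have "f' N \<in> X N" if N: "N \<in> finite_index_normal A" for N
      proof (cases "N \<in> F")
        case True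
        then have "m N \<le> n"
          using fin by (simp add: n_def)
        then have "stab n \<subseteq> N"
          using stab_mono m[OF True] by blast
        then have "f' N = f N"
          using completion_eq_at[OF f'(1) f(2) N _ f'(2)] by blast
        then show ?thesis
          using PiE_mem[OF X(2) N] by simp
      next
        case False
        then have "X N = rcosets\<^bsub>A\<^esub> N"
          using N by (simp add: F_def FactGroup_def)
        then show ?thesis
          using f'(1) N unfolding completion_iff by blast
      qed
      moreover have "f' \<in> extensional (finite_index_normal A)"
        using f'(1) unfolding completion_iff by blast
      ultimately have "f' \<in> Pi\<^sub>E (finite_index_normal A) X"
        by (simp add: PiE_iff)
      then have "f' \<in> U"
        using X(3) by blast
      with f' show ?thesis
        using U(2) by blast
    qed
    then show ?thesis
      by blast
  qed
  with U(2) show "V \<subseteq> completion \<and> (\<forall>f\<in>V. \<exists>n. \<forall>f'\<in>completion. f' (stab n) = f (stab n) \<longrightarrow> f' \<in> V)"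
    by blast
next
  let ?P = "product_topology (\<lambda>N. discrete_topology (carrier (A Mod N))) (finite_index_normal A)"
  assume V: "V \<subseteq> completion \<and> (\<forall>f\<in>V. \<exists>n. \<forall>f'\<in>completion. f' (stab n) = f (stab n) \<longrightarrow> f' \<in> V)"
  have "\<exists>W. openin (profinite_topology A) W \<and> f \<in> W \<and> W \<subseteq> V" if "f \<in> V" for f
  proof -
    from bspec[OF conjunct2[OF V] that]
    obtain n where n: "\<forall>f'\<in>completion. f' (stab n) = f (stab n) \<longrightarrow> f' \<in> V" ..
    have f: "f \<in> completion"
      using V that by blast
    have "continuous_map ?P (discrete_topology (carrier (A Mod (stab n)))) (\<lambda>x. x (stab n))"
      by (rule continuous_map_product_projection[OF stab_finite_index])
    moreover have "f (stab n) \<in> carrier (A Mod (stab n))"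
      using f stab_finite_index unfolding completion_iff by (simp add: FactGroup_def)
    ultimately have "openin ?P {x \<in> topspace ?P. x (stab n) \<in> {f (stab n)}}"
      by (intro openin_continuous_map_preimage) auto
    then have "openin (profinite_topology A) ({x \<in> topspace ?P. x (stab n) \<in> {f (stab n)}} \<inter> completion)"
      unfolding profinite_topology_def openin_subtopology by blast
    moreover have "completion \<subseteq> topspace ?P"
      by (auto simp: profinite_completion_def inverse_limit_def)
    ultimately show ?thesis
      using n f by (intro exI[of _ "{x \<in> topspace ?P. x (stab n) \<in> {f (stab n)}} \<inter> completion"]) blast
  qed
  then show "openin (profinite_topology A) V"
    using openin_subopen by blast
qed

lemma continuous_res_value:
  "continuous_map (profinite_topology A) (subtopology tree_topology (tree_topology closure_of \<Gamma>)) res_value"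
proof -
  have cl: "tree_topology closure_of \<Gamma> \<subseteq> tree_auts"
    by (auto simp: closure_of_tree_topology[OF subset])
  have "openin (profinite_topology A) {f \<in> completion. res_value f \<in> W}"
    if W: "openin (subtopology tree_topology (tree_topology closure_of \<Gamma>)) W" for W
    unfolding openin_profinite_iff
  proof (intro conjI ballI)
    fix f assume "f \<in> {f \<in> completion. res_value f \<in> W}"
    then have f: "f \<in> completion" "res_value f \<in> W"
      by auto
    from bspec[OF conjunct2[OF W[unfolded openin_subtopology_tree_iff[OF cl]]] f(2)]
    obtain n where n: "\<forall>\<beta>\<in>tree_topology closure_of \<Gamma>. agree n \<beta> (res_value f) \<longrightarrow> \<beta> \<in> W" ..
    have "f' \<in> {f \<in> completion. res_value f \<in> W}"
      if "f' \<in> completion" "f' (stab n) = f (stab n)" for f'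
      using n that agree_res_value_iff[OF that(1) f(1)] res_value_closure[OF that(1)] by blast
    then show "\<exists>n. \<forall>f'\<in>completion. f' (stab n) = f (stab n) \<longrightarrow> f' \<in> {f \<in> completion. res_value f \<in> W}"
      by blast
  qed auto
  then show ?thesis
    using res_value_closure by (auto simp: continuous_map_def closure_of_subset_topspace
        topspace_subtopology cl Int_absorb1)
qed

text \<open>
  Injectivity: the components at level stabilizers determine all others. Surjectivity: an element \<open>\<alpha>\<close> of
  the closure is approximated by some \<open>g n \<in> \<Gamma>\<close> on each level \<open>n\<close>, and the coset \<open>N g n\<close> is the same for
  all \<open>n\<close> that are deep enough for \<open>N\<close>.
\<close>

lemma res_value_bij: "bij_betw res_value completion (tree_topology closure_of \<Gamma>)"
proof (rule bij_betw_imageI)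
  show "inj_on res_value completion"
  proof (rule inj_onI)
    fix f f' assume f: "f \<in> completion" and f': "f' \<in> completion" and eq: "res_value f = res_value f'"
    then have "f (stab n) = f' (stab n)" for n
      using agree_res_value_iff[OF f f', of n] by simp
    then have "f N = f' N" if "N \<in> finite_index_normal A" for N
      using congruence[OF that] completion_eq_at[OF f f' that] by blast
    then show "f = f'"
      using f f' unfolding completion_iff by (intro extensionalityI[of f "finite_index_normal A"]) auto
  qed
  show "res_value ` completion = tree_topology closure_of \<Gamma>"
  proof
    show "tree_topology closure_of \<Gamma> \<subseteq> res_value ` completion"
    proof
      fix \<alpha> assume "\<alpha> \<in> tree_topology closure_of \<Gamma>"
      then have \<alpha>: "\<alpha> \<in> tree_auts" "\<forall>n. \<exists>\<gamma>\<in>\<Gamma>. agree n \<gamma> \<alpha>"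
        by (auto simp: closure_of_tree_topology[OF subset])
      obtain g where g: "\<And>n. g n \<in> \<Gamma>" "\<And>n. agree n (g n) \<alpha>"
        using \<alpha>(2) by metis
      obtain m where m: "\<And>N. N \<in> finite_index_normal A \<Longrightarrow> stab (m N) \<subseteq> N"
        using congruence by metis
      have step: "N #>\<^bsub>A\<^esub> g n = N #>\<^bsub>A\<^esub> g k"
        if N: "N \<in> finite_index_normal A" and "stab n \<subseteq> N" "n \<le> k" for N n k
      proof -
        have "agree n (g k) \<alpha>"
          by (rule agree_mono[OF tree_aut[OF g(1)] \<alpha>(1) g(2) \<open>n \<le> k\<close>])
        then have "agree n (g k) (g n)"
          by (rule agree_trans) (rule agree_sym[OF g(2)])
        then have "g k \<in> stab n #>\<^bsub>A\<^esub> g n"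
          using coset_stab[OF g(1)] g(1) by blast
        then have "g k \<in> N #>\<^bsub>A\<^esub> g n"
          using \<open>stab n \<subseteq> N\<close> unfolding r_coset_def by blast
        then show ?thesis
          using A.repr_independence[of "g k" N "g n"] g(1) finite_index_normalD(2)[OF N] by simp
      qed
      have indep: "N #>\<^bsub>A\<^esub> g n = N #>\<^bsub>A\<^esub> g (m N)"
        if N: "N \<in> finite_index_normal A" and "stab n \<subseteq> N" for N n
        using step[OF N that(2), of "max n (m N)"] step[OF N m[OF N], of "max n (m N)"] by (metis max.cobounded1 max.cobounded2)
      define f where "f = (\<lambda>N\<in>finite_index_normal A. N #>\<^bsub>A\<^esub> g (m N))"
      have f: "f N = N #>\<^bsub>A\<^esub> g (m N)" if "N \<in> finite_index_normal A" for N
        unfolding f_def using that by (rule restrict_apply')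
      have "f N \<in> rcosets\<^bsub>A\<^esub> N" if "N \<in> finite_index_normal A" for N
        unfolding f[OF that] using finite_index_normalD(3)[OF that] g(1) by (intro A.rcosetsI) auto
      moreover have "N <#>\<^bsub>A\<^esub> f M = f N"
        if N: "N \<in> finite_index_normal A" and M: "M \<in> finite_index_normal A" and "M \<subseteq> N" for N M
        unfolding f[OF N] f[OF M] coset_refine[OF N M \<open>M \<subseteq> N\<close> g(1)]
        by (rule indep[OF N]) (use m[OF M] \<open>M \<subseteq> N\<close> in blast)
      moreover have "f \<in> extensional (finite_index_normal A)"
        by (simp add: f_def)
      ultimately have mem: "f \<in> completion"
        unfolding completion_iff by blast
      have "res_value f = \<alpha>"
      proof (rule agree_eqI)
        fix n
        have "f (stab n) = stab n #>\<^bsub>A\<^esub> g n"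
          using f[OF stab_finite_index] indep[OF stab_finite_index order_refl] by metis
        then have "f (stab n) = {\<gamma> \<in> \<Gamma>. agree n \<gamma> (g n)}"
          using coset_stab[OF g(1)] by (rule trans)
        then have "g n \<in> f (stab n)"
          using g(1) by simp
        then show "agree n (res_value f) \<alpha>"
          using agree_trans[OF res_value_agree[OF mem] g(2)] by blast
      qed
      with mem show "\<alpha> \<in> res_value ` completion"
        by blast
    qed
  qed (use res_value_closure in blast)
qed

lemma closure_subgroup_mult:
  assumes "f \<in> completion" "f' \<in> completion"
  shows "res_value (f \<otimes>\<^bsub>profinite_completion A\<^esub> f') =
    res_value f \<otimes>\<^bsub>aut_group (tree_topology closure_of \<Gamma>)\<^esub> res_value f'"
  using completion_mult[OF assms] res_value_tree_aut[OF assms(1)] res_value_tree_aut[OF assms(2)] by simp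

lemma is_res_res_value: "is_res \<Gamma> (restrict res_value completion)"
  unfolding is_res_def
proof (intro conjI ballI)
  show "restrict res_value completion
      \<in> hom (profinite_completion A) (aut_group (tree_topology closure_of \<Gamma>))"
    using res_value_closure closure_subgroup_mult completion_mult(1)
    by (auto simp: hom_def simp del: tree_Aut_mult)
  show "continuous_map (profinite_topology A) (subtopology tree_topology (tree_topology closure_of \<Gamma>))
      (restrict res_value completion)"
    by (rule continuous_map_eq[OF continuous_res_value]) simp
  show "restrict res_value completion (completion_map A \<gamma>) = \<gamma>" if "\<gamma> \<in> \<Gamma>" for \<gamma>
    using completion_map_mem[OF that] by simp
qed simp

text \<open>
  The elements of \<open>\<Gamma>\<close> are dense in the completion, so \<open>r f\<close> can be compared on each level with an
  element \<open>\<gamma>\<close> close to \<open>f\<close>, at which the value of \<open>r\<close> is prescribed.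
\<close>

lemma is_res_unique:
  assumes r: "is_res \<Gamma> r"
  shows "r = restrict res_value completion"
proof (rule extensionalityI[of _ completion])
  have cl: "tree_topology closure_of \<Gamma> \<subseteq> tree_auts"
    by (auto simp: closure_of_tree_topology[OF subset])
  have cont: "continuous_map (profinite_topology A) (subtopology tree_topology (tree_topology closure_of \<Gamma>)) r"
    and ext: "\<And>\<gamma>. \<gamma> \<in> \<Gamma> \<Longrightarrow> r (completion_map A \<gamma>) = \<gamma>"
    using r unfolding is_res_def by blast+
  show "r \<in> extensional completion"
    using r unfolding is_res_def by blast
  fix f assume f: "f \<in> completion"
  have "agree n (r f) (res_value f)" for n
  proof -
    let ?W = "{\<beta> \<in> tree_topology closure_of \<Gamma>. agree n \<beta> (r f)}"
    have rf: "r f \<in> tree_topology closure_of \<Gamma>"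
      using continuous_map_image_subset_topspace[OF cont] f by auto
    have "openin (subtopology tree_topology (tree_topology closure_of \<Gamma>)) ?W"
      unfolding openin_subtopology_tree_iff[OF cl] by (auto intro: agree_trans)
    then have "openin (profinite_topology A) {f' \<in> topspace (profinite_topology A). r f' \<in> ?W}"
      by (rule openin_continuous_map_preimage[OF cont])
    then have V: "openin (profinite_topology A) {f' \<in> completion. r f' \<in> ?W}"
      by simp
    have "f \<in> {f' \<in> completion. r f' \<in> ?W}"
      using f rf by simp
    from bspec[OF conjunct2[OF V[unfolded openin_profinite_iff]] this]
    obtain k where k: "\<forall>f'\<in>completion. f' (stab k) = f (stab k) \<longrightarrow> f' \<in> {f' \<in> completion. r f' \<in> ?W}" ..
    obtain \<gamma> where \<gamma>: "\<gamma> \<in> f (stab (max k n))" "\<gamma> \<in> \<Gamma>"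
      using coset_repr_exists[OF f stab_finite_index] by metis
    note c = completion_map_mem[OF \<gamma>(2)]
    have agree: "agree j (res_value f) \<gamma>" if "j \<le> max k n" for j
      using agree_mono[OF res_value_tree_aut[OF f] tree_aut[OF \<gamma>(2)] res_value_agree[OF f \<gamma>(1)] that] .
    have "completion_map A \<gamma> (stab k) = f (stab k)"
      using agree_res_value_iff[OF c(1) f, of k] agree_sym[OF agree[of k]] c(2) by simp
    then have "agree n \<gamma> (r f)"
      using bspec[OF k c(1)] ext[OF \<gamma>(2)] by simp
    then show ?thesis
      using agree_trans[OF agree[of n]] by (simp add: agree_sym)
  qed
  then have "r f = res_value f"
    by (rule agree_eqI)
  then show "r f = restrict res_value completion f"
    using f by simp
qed simp

lemma res_tree_eq: "res_tree \<Gamma> = restrict res_value completion"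
  unfolding res_tree_def using is_res_res_value is_res_unique by (rule the_equality)

theorem res_tree_iso:
  "res_tree \<Gamma> \<in> iso (profinite_completion A) (aut_group (tree_topology closure_of \<Gamma>))"
proof -
  have "bij_betw (restrict res_value completion) completion (tree_topology closure_of \<Gamma>)"
    using res_value_bij by (subst bij_betw_cong[of _ _ res_value]) auto
  then show ?thesis
    using is_res_res_value unfolding res_tree_eq iso_def is_res_def by simp
qed

text \<open>
  Two families have the same component at \<open>stab n\<close> exactly if their images agree on level \<open>n\<close>, so open
  sets are mapped to open sets.
\<close>

theorem res_tree_homeomorphic:
  "homeomorphic_map (profinite_topology A)
     (subtopology tree_topology (tree_topology closure_of \<Gamma>)) (res_tree \<Gamma>)"
proof -
  have cl: "tree_topology closure_of \<Gamma> \<subseteq> tree_auts"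
    by (auto simp: closure_of_tree_topology[OF subset])
  have "openin (subtopology tree_topology (tree_topology closure_of \<Gamma>)) (res_value ` V)"
    if V: "openin (profinite_topology A) V" for V
    unfolding openin_subtopology_tree_iff[OF cl]
  proof (intro conjI ballI)
    have sub: "V \<subseteq> completion"
      using V unfolding openin_profinite_iff by blast
    then show "res_value ` V \<subseteq> tree_topology closure_of \<Gamma>"
      using res_value_closure by blast
    fix \<alpha> assume "\<alpha> \<in> res_value ` V"
    then obtain f where f: "f \<in> V" "\<alpha> = res_value f"
      by blast
    from bspec[OF conjunct2[OF V[unfolded openin_profinite_iff]] f(1)]
    obtain n where n: "\<forall>f'\<in>completion. f' (stab n) = f (stab n) \<longrightarrow> f' \<in> V" ..
    have "\<beta> \<in> res_value ` V" if \<beta>: "\<beta> \<in> tree_topology closure_of \<Gamma>" "agree n \<beta> \<alpha>" for \<beta>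
    proof -
      obtain f' where f': "f' \<in> completion" "\<beta> = res_value f'"
        using \<beta>(1) res_value_bij by (auto simp: bij_betw_def)
      have "f' (stab n) = f (stab n)"
        using agree_res_value_iff[of f' f n] f f' sub \<beta>(2) by blast
      then show ?thesis
        using n f' by blast
    qed
    then show "\<exists>n. \<forall>\<beta>\<in>tree_topology closure_of \<Gamma>. agree n \<beta> \<alpha> \<longrightarrow> \<beta> \<in> res_value ` V"
      by blast
  qed
  then have "homeomorphic_map (profinite_topology A)
     (subtopology tree_topology (tree_topology closure_of \<Gamma>)) res_value"
    using res_value_bij continuous_res_value unfolding bij_betw_def
    by (intro bijective_open_imp_homeomorphic_map) (simp_all add: open_map_def Int_absorb1[OF cl])
  then show ?thesis
    unfolding res_tree_eq by (rule homeomorphic_map_eq) simp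
qed

end


section \<open>The congruence subgroup property of the generated groups\<close>

context perfect_self_similar
begin

text \<open>
  If \<open>N\<close> is trivial, finite index makes the group finite, and a finite group acts faithfully on some
  level.
\<close>

lemma congruence_Gamma:
  assumes \<Omega>: "spines \<Omega>"
  shows "congruence_tree_subgroup (Gamma b G \<Omega>)"
proof -
  interpret \<Gamma>: tree_subgroup "Gamma b G \<Omega>"
    by (rule tree_subgroup.intro[OF Gamma_subgroup])
  show ?thesis
  proof (intro congruence_tree_subgroup.intro congruence_tree_subgroup_axioms.intro \<Gamma>.tree_subgroup_axioms)
    fix N assume N: "N \<in> finite_index_normal \<Gamma>.A"
    then have norm: "N \<subseteq> Gamma b G \<Omega>" "subgroup N tree_Aut"
      "\<And>\<gamma> \<nu>. \<gamma> \<in> Gamma b G \<Omega> \<Longrightarrow> \<nu> \<in> N \<Longrightarrow> \<gamma> \<circ> \<nu> \<circ> inverse_map \<gamma> \<in> N"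
      using \<Gamma>.normal_iff[of N] \<Gamma>.finite_index_normalD(1)[OF N] by blast+
    show "\<exists>n. \<Gamma>.stab n \<subseteq> N"
    proof (cases "\<exists>\<nu>\<in>N. \<exists>v. \<nu> v \<noteq> v")
      case True
      then obtain \<nu> v where \<nu>: "\<nu> \<in> N" "\<nu> v \<noteq> v"
        by blast
      have "\<Gamma>.stab (length v) \<subseteq> N"
        using normal_subgroup_contains_level_stab[OF \<Omega> norm(2,3) \<nu>] by (auto simp: \<Gamma>.stab_iff)
      then show ?thesis ..
    next
      case False
      then have "N = {id}"
        using subgroup_tree_AutD(2)[OF norm(2)] by (auto simp: fun_eq_iff)
      then have "N #>\<^bsub>\<Gamma>.A\<^esub> \<gamma> = {\<gamma>}" if "\<gamma> \<in> Gamma b G \<Omega>" for \<gamma>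
        using that Gamma_aut[OF that] unfolding r_coset_def by simp
      then have "rcosets\<^bsub>\<Gamma>.A\<^esub> N = (\<lambda>\<gamma>. {\<gamma>}) ` Gamma b G \<Omega>"
        unfolding RCOSETS_def by auto
      then have "finite ((\<lambda>\<gamma>. {\<gamma>}) ` Gamma b G \<Omega>)"
        using N by (simp add: finite_index_normal_def)
      then have fin: "finite (Gamma b G \<Omega>)"
        by (rule finite_imageD) simp
      obtain w where w: "\<And>\<gamma>. \<gamma> \<in> Gamma b G \<Omega> \<Longrightarrow> \<gamma> \<noteq> id \<Longrightarrow> \<gamma> (w \<gamma>) \<noteq> w \<gamma>"
        by (metis ext id_apply)
      define n where "n = Max (insert 0 ((length \<circ> w) ` Gamma b G \<Omega>))"
      have "\<gamma> = id" if "\<gamma> \<in> \<Gamma>.stab n" for \<gamma>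
      proof (rule ccontr)
        have \<gamma>: "\<gamma> \<in> Gamma b G \<Omega>" "agree n \<gamma> id"
          using that unfolding \<Gamma>.stab_iff by blast+
        have "length (w \<gamma>) \<le> n"
          unfolding n_def using fin \<gamma>(1) by (intro Max_ge) auto
        then have "\<gamma> (w \<gamma>) = w \<gamma>"
          using agree_le[OF Gamma_aut[OF \<gamma>(1)] id_tree_aut \<gamma>(2)] by simp
        moreover assume "\<gamma> \<noteq> id"
        ultimately show False
          using w[OF \<gamma>(1)] by blast
      qed
      then have "\<Gamma>.stab n \<subseteq> N"
        unfolding \<open>N = {id}\<close> by blast
      then show ?thesis ..
    qed
  qed
qed

lemma closure_Gamma:
  assumes \<Omega>: "spines \<Omega>"
  shows "tree_topology closure_of (Gamma b G \<Omega>) = wreath_infinity Q"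
proof (rule Set.set_eqI)
  show "\<alpha> \<in> tree_topology closure_of (Gamma b G \<Omega>) \<longleftrightarrow> \<alpha> \<in> wreath_infinity Q" for \<alpha>
    using closure_Gamma_iff[OF \<Omega>, of \<alpha>] Gamma_aut
    by (simp add: closure_of_tree_topology subset_iff wreath_infinity_iff)
qed

end

theorem corollary4p6:
  fixes b :: "'a::finite"
    and G :: "('a list \<Rightarrow> 'a list) set"
    and Q :: "('a \<Rightarrow> 'a) set"
    and \<Omega> :: "(nat \<Rightarrow> 'a) set"
  assumes "subgroup G tree_Aut"
    and "perfect_group (aut_group G)"
    and "self_similar G"
    and "property_H G"
    and "Q = level_perm ` G"
    and "\<Omega> \<subseteq> letter_seqs b"
    and "\<Omega> \<noteq> {}"
  shows "res_tree (Gamma b G \<Omega>)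
           \<in> iso (profinite_completion (aut_group (Gamma b G \<Omega>))) (aut_group (wreath_infinity Q)) \<and>
         homeomorphic_map (profinite_topology (aut_group (Gamma b G \<Omega>)))
           (subtopology tree_topology (wreath_infinity Q)) (res_tree (Gamma b G \<Omega>))"
proof -
  interpret perfect_self_similar b G
    by (rule perfect_self_similar.intro[OF assms(1-4)])
  have \<Omega>: "spines \<Omega>"
    using assms(6,7) by (simp add: spines_def)
  interpret \<Gamma>: congruence_tree_subgroup "Gamma b G \<Omega>"
    by (rule congruence_Gamma[OF \<Omega>])
  show ?thesis
    using \<Gamma>.res_tree_iso \<Gamma>.res_tree_homeomorphic by (simp only: closure_Gamma[OF \<Omega>] assms(5))
qed

end
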